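(* Let $K_n(C)$ (for real $C\ge 1$ and integer $n\ge 1$) be the supremum of $\|R(\lambda,T)\|\cdot \mathrm{dist}(\lambda,\sigma(T))$ over power-bounded operators $T$ on $n$-dimensional normed spaces with power bound $C$ and over points $\lambda\notin\sigma(T)$ with $|\lambda|\ge 1$, as defined in the context. Then: (i) For every integer $n\ge 1$ and every real $C\ge 1$, $$K_n(C)\le C\left(\frac{5\pi}{3}+2\sqrt{2}\right)n^{3/2}.$$ (ii) Moreover, for every real $C\ge 1$, $$\limsup_{n\to\infty} n^{-3/2}K_n(C)\le \frac{5\pi}{3}\,C.$$
   Context: For a linear operator $T$ on $\mathbb{C}^n$, $\sigma(T)\subset\mathbb{C}$ denotes its spectrum (set of eigenvalues), $R(\lambda,T)=(\lambda I-T)^{-1}$ its resolvent at $\lambda\notin\sigma(T)$, and $\mathrm{dist}(\lambda,\sigma(T))=\min_{\mu\in\sigma(T)}|\lambda-\mu|$. If $|\cdot|$ is a norm on the complex vector space $\mathbb{C}^n$ and $E=(\mathbb{C}^n,|\cdot|)$, then $\|\cdot\|=\|\cdot\|_{E\to E}$ denotes the associated operator norm. For real $C\ge 1$ and integer $n\ge 1$, $$K_n(C)=\sup \|R(\lambda,T)\|_{E\to E}\,\mathrm{dist}(\lambda,\sigma(T)),$$ where the supremum is taken over all norms $|\cdot|$ on $\mathbb{C}^n$ (with $E=(\mathbb{C}^n,|\cdot|)$), all linear operators $T:E\to E$ satisfying $\|T^k\|_{E\to E}\le C$ for every integer $k\ge 0$, and all $\lambda\in\mathbb{C}$ with $|\lambda|\ge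 1$ and $\lambda\notin\sigma(T)$. *)

theory Defs
  imports
    "Jordan_Normal_Form.Spectral_Radius"
    "Jordan_Normal_Form.Gauss_Jordan_Elimination"
    "HOL-Library.Extended_Real"
begin

text \<open>
  The dimension \<open>n\<close> has to vary inside the statement, so \<open>\<complex>\<^sup>n\<close> is the carrier set
  \<^term>\<open>carrier_vec n :: complex vec set\<close>, and a linear operator on \<open>\<complex>\<^sup>n\<close> is an element of
  \<^term>\<open>carrier_mat n n :: complex mat set\<close>, acting by \<^term>\<open>mult_mat_vec\<close>.
  A norm on \<open>\<complex>\<^sup>n\<close> is a function on all vectors of which only the values on the carrier matter.
\<close>

definition is_norm :: "nat \<Rightarrow> (complex vec \<Rightarrow> real) \<Rightarrow> bool" where
  "is_norm n \<nu> \<longleftrightarrow>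
     (\<forall>v \<in> carrier_vec n. 0 \<le> \<nu> v \<and> (\<nu> v = 0 \<longleftrightarrow> v = 0\<^sub>v n)) \<and>
     (\<forall>c. \<forall>v \<in> carrier_vec n. \<nu> (c \<cdot>\<^sub>v v) = cmod c * \<nu> v) \<and>
     (\<forall>v \<in> carrier_vec n. \<forall>w \<in> carrier_vec n. \<nu> (v + w) \<le> \<nu> v + \<nu> w)"

text \<open>
  The supremum is taken in the extended reals, so that its being a genuine supremum does not
  depend on a boundedness proof; its value is finite because the dimension is finite.
\<close>

definition op_norm :: "nat \<Rightarrow> (complex vec \<Rightarrow> real) \<Rightarrow> complex mat \<Rightarrow> ereal" where
  "op_norm n \<nu> A = (SUP v \<in> {v \<in> carrier_vec n. \<nu> v \<le> 1}. ereal (\<nu> (A *\<^sub>v v)))"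

definition resolvent :: "nat \<Rightarrow> complex \<Rightarrow> complex mat \<Rightarrow> complex mat" where
  "resolvent n z T = the (mat_inverse (z \<cdot>\<^sub>m 1\<^sub>m n - T))"

lemma resolvent_is_inverse:
  assumes T: "T \<in> carrier_mat n n" and z: "z \<notin> spectrum T"
  shows "resolvent n z T \<in> carrier_mat n n"
    and "(z \<cdot>\<^sub>m 1\<^sub>m n - T) * resolvent n z T = 1\<^sub>m n"
    and "resolvent n z T * (z \<cdot>\<^sub>m 1\<^sub>m n - T) = 1\<^sub>m n"
proof -
  let ?A = "z \<cdot>\<^sub>m 1\<^sub>m n - T"
  have A: "?A \<in> carrier_mat n n"
    using T by auto
  have "det ?A \<noteq> 0"
  proof
    assume "det ?A = 0"
    then obtain v where v: "v \<in> carrier_vec n" "v \<noteq> 0\<^sub>v n" "?A *\<^sub>v v = 0\<^sub>v n"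
      using det_0_iff_vec_prod_zero[OF A] by blast
    have "?A *\<^sub>v v = z \<cdot>\<^sub>v v - T *\<^sub>v v"
      using T v(1) by (subst minus_mult_distrib_mat_vec[of _ n n]) auto
    with v(3) have eq: "z \<cdot>\<^sub>v v - T *\<^sub>v v = 0\<^sub>v n"
      by simp
    have "T *\<^sub>v v = z \<cdot>\<^sub>v v"
    proof (rule eq_vecI)
      fix i assume "i < dim_vec (z \<cdot>\<^sub>v v)"
      then have i: "i < n"
        using v(1) by simp
      have "(z \<cdot>\<^sub>v v - T *\<^sub>v v) $ i = 0"
        using eq i by simp
      then show "(T *\<^sub>v v) $ i = (z \<cdot>\<^sub>v v) $ i"
        using i v(1) T by simp
    qed (use T v(1) in auto)
    then show False
      using z v T by (auto simp: spectrum_def eigenvalue_def eigenvector_def)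
  qed
  then have "mat_inverse ?A \<noteq> None"
    using mat_inverse(1)[OF A, where b = "()"] det_non_zero_imp_unit[OF A, where b = "()"]
    by blast
  then obtain B where "mat_inverse ?A = Some B"
    by blast
  with mat_inverse(2)[OF A this]
  show "resolvent n z T \<in> carrier_mat n n"
    and "?A * resolvent n z T = 1\<^sub>m n" and "resolvent n z T * ?A = 1\<^sub>m n"
    by (auto simp: resolvent_def)
qed

definition spec_dist :: "complex \<Rightarrow> complex mat \<Rightarrow> real" where
  "spec_dist z T = (MIN \<mu> \<in> spectrum T. cmod (z - \<mu>))"

definition power_bounded :: "nat \<Rightarrow> (complex vec \<Rightarrow> real) \<Rightarrow> real \<Rightarrow> complex mat \<Rightarrow> bool" where
  "power_bounded n \<nu> C T \<longleftrightarrow> (\<forall>k. op_norm n \<nu> (T ^\<^sub>m k) \<le> ereal C)"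

definition K :: "nat \<Rightarrow> real \<Rightarrow> ereal" where
  "K n C = Sup {op_norm n \<nu> (resolvent n z T) * ereal (spec_dist z T) | \<nu> T z.
     is_norm n \<nu> \<and> T \<in> carrier_mat n n \<and> power_bounded n \<nu> C T \<and>
     1 \<le> cmod z \<and> z \<notin> spectrum T}"

end

theory Submission
  imports Defs "HOL-Computational_Algebra.Formal_Power_Series"
begin

text \<open>
  If \<open>T\<close> has power bound \<open>C\<close> and \<open>f\<close> is a power series, then \<open>f(T)\<close> has norm at most \<open>C\<close> times the sum of
  the moduli of the coefficients of \<open>f\<close>. So it suffices to find an \<open>f\<close> with \<open>f(T) = R(z,T)\<close> and a small
  coefficient sum. Only the values of \<open>f\<close> at the eigenvalues \<open>a\<^sub>1, \<dots>, a\<^sub>n\<close> matter (with multiplicities), and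
  with the Blaschke product \<open>B\<close> of the eigenvalues the function \<open>f(x) = (1 - B(x) / B(z)) / (z - x)\<close> qualifies
  by the Cayley-Hamilton theorem (lemmas \<open>interp_identity\<close>, \<open>cayley_hamilton\<close>, \<open>resolvent_series\<close>).

  The coefficient sum of \<open>f\<close> is estimated by Hardy's inequality
  \<open>\<Sum>m. cmod (g\<^sub>m) / (m + 1) \<le> pi * s\<close> for the derivative \<open>g\<close> of \<open>f\<close>, where \<open>s\<close> bounds the
  \<open>H\<^sup>1\<close>-norm of \<open>g\<close> (\<open>hardy_ineq\<close>). For the purpose at hand it is enough to know it for sums of products
  of functions in \<open>H\<^sup>2\<close>, where it is Hilbert's double series inequality (\<open>hilbert_ineq\<close>).
  Let \<open>d\<close> be the distance from \<open>z\<close> to the spectrum. Building up \<open>f\<close> one Blaschke factor at a time, one finds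
  \<open>d\<^sup>2 * \<parallel>f\<parallel>\<^sup>2 \<le> \<Sum>k. 1 - (cmod a\<^sub>k)\<^sup>2\<close> in \<open>H\<^sup>2\<close>, because the added terms are orthogonal
  (\<open>l2_le_interp\<close>), and each factor contributes to the derivative at most
  \<open>1 + sqrt (2 / (1 - (cmod a\<^sub>k)\<^sup>2)) * sqrt (\<Sum>j>k. 1 - (cmod a\<^sub>j)\<^sup>2)\<close>, divided by \<open>d\<close>.
  If the eigenvalues are ordered by increasing modulus, the \<open>k\<close>-th contribution is at most
  \<open>1 + sqrt (2 * (n - k))\<close> (\<open>h1_le_deriv_interp\<close>). Summation gives the main term
  \<open>pi * (2 * sqrt 2 / 3) * n powr (3 / 2)\<close> and terms of lower order (\<open>wiener_norm_interp\<close>). As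
  \<open>2 * sqrt 2 / 3 < 5 / 3\<close>, both claims follow.

  All of this requires the eigenvalues to lie inside the open disc. Power boundedness gives the closed
  disc, and \<open>resolvent_estimate\<close> removes the difference by replacing \<open>T\<close> with \<open>(1 - t) T\<close>.
\<close>

section \<open>Hilbert's inequality\<close>

text \<open>
  The function \<open>x \<mapsto> sqrt a / ((a + x) * sqrt x)\<close> is convex with antiderivative
  \<open>2 * arctan (sqrt (x / a))\<close>, so its value at the midpoint of a unit interval is at most its integral
  over that interval.
\<close>
lemma hilbert_kernel_midpoint:
  fixes a m :: real
  assumes a: "a > 0" and m: "m \<ge> 1/2"
  shows "sqrt a / ((a + m) * sqrt m) \<le> 2 * arctan (sqrt ((m + 1/2) / a)) - 2 * arctan (sqrt ((m - 1/2) / a))"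
proof -
  define g where "g = (\<lambda>x. sqrt a / ((a + x) * sqrt x))"
  define G where "G = (\<lambda>x. 2 * arctan (sqrt (x / a)))"
  have G': "(G has_real_derivative g x) (at x)" if "x > 0" for x
  proof -
    define b c where "b = sqrt a" and "c = sqrt x"
    have b: "b > 0" "a = b\<^sup>2" and c: "c > 0" "x = c\<^sup>2"
      using a that by (simp_all add: b_def c_def)
    have "((\<lambda>x. sqrt (x / a)) has_real_derivative 1 / a * (inverse (sqrt (x / a)) / 2)) (at x)"
    proof -
      have "x / a > 0" using a that by simp
      from DERIV_chain2[OF DERIV_real_sqrt[OF this] DERIV_cdivide[OF DERIV_ident]]
      show ?thesis by (subst mult.commute)
    qed
    then have 1: "(G has_real_derivative 2 * (inverse (1 + (sqrt (x / a))\<^sup>2) * (1 / a * (inverse (sqrt (x / a)) / 2)))) (at x)"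
      unfolding G_def
      by (intro DERIV_cmult DERIV_chain2[where f = arctan] DERIV_arctan)
    have 2: "sqrt (x / a) = c / b"
      by (simp add: real_sqrt_divide b_def c_def)
    have 3: "2 * (inverse y * (1 / a * (inverse z / 2))) = 1 / (y * (a * z))" for y z :: real
      by (simp add: inverse_eq_divide)
    have 4: "(1 + (c / b)\<^sup>2) * (a * (c / b)) = (b\<^sup>2 + c\<^sup>2) * c / b"
    proof -
      have "(1 + q\<^sup>2) * (b\<^sup>2 * q) = (b\<^sup>2 + (q * b)\<^sup>2) * q" for q
        by (simp add: power2_eq_square algebra_simps)
      from this[of "c / b"] show ?thesis using b by simp
    qed
    have 5: "g x = b / ((b\<^sup>2 + c\<^sup>2) * c)"
      unfolding g_def b_def[symmetric] c_def[symmetric] b(2)[symmetric] c(2)[symmetric] by simp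
    show ?thesis using 1 unfolding 2 3 4 5 by simp
  qed
  \<comment> \<open>Midpoint convexity, by the arithmetic-geometric mean inequality from \<open>g (m + h) * g (m - h) \<ge> (g m)\<^sup>2\<close>.\<close>
  have gm: "2 * g m \<le> g (m + h) + g (m - h)" if h: "0 < h" "h < 1/2" for h
  proof -
    have pos: "g (m + h) > 0" "g (m - h) > 0" "g m > 0"
      using a m h by (auto simp: g_def intro!: divide_pos_pos mult_pos_pos)
    have am: "a + m > 0" using a m by linarith
    have "(g m)\<^sup>2 = a / ((a + m)\<^sup>2 * m)"
      using a m by (simp add: g_def power_divide power_mult_distrib)
    also have "\<dots> = a / ((a + m)\<^sup>2 * sqrt (m\<^sup>2))"
      using m by simp
    also have "\<dots> \<le> a / (((a + m)\<^sup>2 - h\<^sup>2) * sqrt (m\<^sup>2 - h\<^sup>2))"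
    proof (intro divide_left_mono mult_mono)
      have "h\<^sup>2 < m\<^sup>2" using h m by (intro power_strict_mono) auto
      moreover have "m\<^sup>2 \<le> (a + m)\<^sup>2" using a m by (intro power_mono) auto
      ultimately have "h\<^sup>2 < (a + m)\<^sup>2" by linarith
      then show "0 < (a + m)\<^sup>2 * sqrt (m\<^sup>2) * (((a + m)\<^sup>2 - h\<^sup>2) * sqrt (m\<^sup>2 - h\<^sup>2))"
        using m am \<open>h\<^sup>2 < m\<^sup>2\<close> by (intro mult_pos_pos) auto
      show "0 \<le> sqrt (m\<^sup>2 - h\<^sup>2)" using \<open>h\<^sup>2 < m\<^sup>2\<close> by simp
      show "sqrt (m\<^sup>2 - h\<^sup>2) \<le> sqrt (m\<^sup>2)"
        by (rule real_sqrt_le_mono) simp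
    qed (use a in auto)
    also have "\<dots> = g (m + h) * g (m - h)"
    proof -
      have "sqrt (m\<^sup>2 - h\<^sup>2) = sqrt (m + h) * sqrt (m - h)"
        by (simp add: real_sqrt_mult[symmetric] power2_eq_square algebra_simps)
      moreover have "(a + m)\<^sup>2 - h\<^sup>2 = (a + (m + h)) * (a + (m - h))"
        by (simp add: power2_eq_square algebra_simps)
      ultimately show ?thesis
        using a by (simp add: g_def)
    qed
    finally have 1: "(g m)\<^sup>2 \<le> g (m + h) * g (m - h)" .
    have "4 * (g (m + h) * g (m - h)) \<le> (g (m + h) + g (m - h))\<^sup>2"
      using zero_le_power2[of "g (m + h) - g (m - h)"]
      by (simp add: power2_eq_square algebra_simps)
    with 1 have "(2 * g m)\<^sup>2 \<le> (g (m + h) + g (m - h))\<^sup>2"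
      by (simp add: power_mult_distrib)
    then show ?thesis
      by (rule power2_le_imp_le) (use pos in auto)
  qed
  define \<phi> where "\<phi> = (\<lambda>h. G (m + h) - G (m - h) - 2 * h * g m)"
  have "\<phi> 0 \<le> \<phi> (1/2)"
  proof (rule DERIV_nonneg_imp_increasing_open[where f = \<phi>])
    fix h :: real assume h: "0 < h" "h < 1/2"
    have "((\<lambda>h. m + h) has_real_derivative 1) (at h)" "((\<lambda>h. m - h) has_real_derivative - 1) (at h)"
      "((\<lambda>h. 2 * h * g m) has_real_derivative 2 * g m) (at h)"
      by (auto intro!: derivative_eq_intros)
    from DERIV_diff[OF DERIV_diff[OF DERIV_chain2[OF G' this(1)] DERIV_chain2[OF G' this(2)]] this(3)]
    have "(\<phi> has_real_derivative g (m + h) * 1 - g (m - h) * (- 1) - 2 * g m) (at h)"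
      unfolding \<phi>_def using h m by simp
    then show "\<exists>y. (\<phi> has_real_derivative y) (at h) \<and> 0 \<le> y"
      using gm[OF h] by (intro exI conjI) auto
  next
    show "continuous_on {0..1/2} \<phi>"
      unfolding \<phi>_def G_def using a by (intro continuous_intros) auto
  qed auto
  then show ?thesis
    by (simp add: \<phi>_def g_def G_def)
qed

lemma hilbert_kernel_row_sum:
  fixes a :: real
  assumes a: "a > 0"
  shows "(\<Sum>l<M. sqrt a / ((a + (real l + 1/2)) * sqrt (real l + 1/2))) \<le> pi"
proof -
  have "(\<Sum>l<M. sqrt a / ((a + (real l + 1/2)) * sqrt (real l + 1/2))) \<le>
     (\<Sum>l<M. 2 * arctan (sqrt (real (Suc l) / a)) - 2 * arctan (sqrt (real l / a)))"
  proof (rule sum_mono)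
    fix l
    show "sqrt a / ((a + (real l + 1/2)) * sqrt (real l + 1/2))
      \<le> 2 * arctan (sqrt (real (Suc l) / a)) - 2 * arctan (sqrt (real l / a))"
      using hilbert_kernel_midpoint[OF a, of "real l + 1/2"] by (simp add: add.commute)
  qed
  also have "\<dots> = 2 * arctan (sqrt (real M / a)) - 2 * arctan (sqrt (real 0 / a))"
    by (rule sum_lessThan_telescope)
  also have "\<dots> \<le> pi"
    using arctan_ubound[of "sqrt (real M / a)"] by simp
  finally show ?thesis .
qed

text \<open>
  Schur's test with the weight \<open>\<rho> i l\<close>: weighted Cauchy-Schwarz splits every product, and the
  row sums of the weighted kernel telescope to at most \<open>pi\<close>.
\<close>
lemma hilbert_ineq_sum:
  fixes x y :: "nat \<Rightarrow> real"
  assumes "\<And>i. 0 \<le> x i" "\<And>i. 0 \<le> y i"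
  shows "(\<Sum>i<M. \<Sum>l<M. x i * y l / (real i + real l + 1))
     \<le> pi / 2 * ((\<Sum>i<M. (x i)\<^sup>2) + (\<Sum>l<M. (y l)\<^sup>2))"
proof -
  \<comment> \<open>The kernel \<open>k\<close> is symmetric and exchanging the indices inverts \<open>\<rho>\<close>, so the bound for rows serves columns as well.\<close>
  define \<rho> where "\<rho> = (\<lambda>i l :: nat. sqrt (real i + 1/2) / sqrt (real l + 1/2))"
  define k where "k = (\<lambda>i l :: nat. 1 / (real i + real l + 1))"
  have row: "(\<Sum>l<M. k i l * \<rho> i l) \<le> pi" for i
    using hilbert_kernel_row_sum[of "real i + 1/2" M]
    by (simp add: k_def \<rho>_def mult.commute algebra_simps)
  have \<rho>: "\<rho> i l > 0" for i l by (simp add: \<rho>_def)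
  have pair: "x i * y l / (real i + real l + 1)
      \<le> 1/2 * ((x i)\<^sup>2 * (k i l * \<rho> i l) + (y l)\<^sup>2 * (k l i * \<rho> l i))" for i l
  proof -
    have "0 \<le> (x i * \<rho> i l - y l)\<^sup>2 / \<rho> i l"
      using \<rho> by (simp add: less_imp_le)
    also have "\<dots> = (x i)\<^sup>2 * \<rho> i l + (y l)\<^sup>2 / \<rho> i l - 2 * (x i * y l)"
      using \<rho>[of i l] by (simp add: power2_eq_square field_simps)
    finally have "k i l * (x i * y l) \<le> k i l * (1/2 * ((x i)\<^sup>2 * \<rho> i l + (y l)\<^sup>2 / \<rho> i l))"
      by (intro mult_left_mono) (auto simp: k_def)
    moreover have "k l i = k i l" "\<rho> l i = 1 / \<rho> i l"
      by (simp_all add: k_def \<rho>_def add.commute)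
    ultimately show ?thesis
      by (simp add: k_def algebra_simps)
  qed
  have "(\<Sum>i<M. \<Sum>l<M. x i * y l / (real i + real l + 1)) \<le>
     (\<Sum>i<M. \<Sum>l<M. 1/2 * ((x i)\<^sup>2 * (k i l * \<rho> i l) + (y l)\<^sup>2 * (k l i * \<rho> l i)))"
    by (intro sum_mono pair)
  also have "\<dots> = 1/2 * ((\<Sum>i<M. (x i)\<^sup>2 * (\<Sum>l<M. k i l * \<rho> i l))
      + (\<Sum>i<M. \<Sum>l<M. (y l)\<^sup>2 * (k l i * \<rho> l i)))"
    by (simp add: sum.distrib sum_distrib_left distrib_left)
  also have "(\<Sum>i<M. \<Sum>l<M. (y l)\<^sup>2 * (k l i * \<rho> l i)) = (\<Sum>l<M. (y l)\<^sup>2 * (\<Sum>i<M. k l i * \<rho> l i))"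
    by (subst sum.swap) (simp add: sum_distrib_left)
  also have "1/2 * ((\<Sum>i<M. (x i)\<^sup>2 * (\<Sum>l<M. k i l * \<rho> i l)) + (\<Sum>l<M. (y l)\<^sup>2 * (\<Sum>i<M. k l i * \<rho> l i)))
     \<le> 1/2 * ((\<Sum>i<M. (x i)\<^sup>2 * pi) + (\<Sum>l<M. (y l)\<^sup>2 * pi))"
    by (intro mult_left_mono add_mono sum_mono row) auto
  also have "\<dots> = pi / 2 * ((\<Sum>i<M. (x i)\<^sup>2) + (\<Sum>l<M. (y l)\<^sup>2))"
    unfolding sum_distrib_right[symmetric] by (simp add: algebra_simps)
  finally show ?thesis .
qed

text \<open>
  Rescaling both sequences to unit length turns the sum of the squared lengths into a product.
\<close>
lemma hilbert_ineq:
  fixes x y :: "nat \<Rightarrow> real"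
  assumes x: "\<And>i. 0 \<le> x i" and y: "\<And>i. 0 \<le> y i" and s: "0 \<le> s" and t: "0 \<le> t"
    and xs: "(\<Sum>i<M. (x i)\<^sup>2) \<le> s\<^sup>2" and yt: "(\<Sum>l<M. (y l)\<^sup>2) \<le> t\<^sup>2"
  shows "(\<Sum>i<M. \<Sum>l<M. x i * y l / (real i + real l + 1)) \<le> pi * (s * t)"
proof (cases "s = 0 \<or> t = 0")
  case True
  then have "(\<forall>i<M. x i = 0) \<or> (\<forall>i<M. y i = 0)"
  proof
    assume "s = 0"
    then have "(\<Sum>i<M. (x i)\<^sup>2) = 0" using xs by (simp add: antisym sum_nonneg)
    then show ?thesis by (simp add: sum_nonneg_eq_0_iff)
  next
    assume "t = 0"
    then have "(\<Sum>i<M. (y i)\<^sup>2) = 0" using yt by (simp add: antisym sum_nonneg)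
    then show ?thesis by (simp add: sum_nonneg_eq_0_iff)
  qed
  then have "(\<Sum>i<M. \<Sum>l<M. x i * y l / (real i + real l + 1)) = 0"
    by (intro sum.neutral ballI) auto
  then show ?thesis using s t by simp
next
  case False
  with s t have pos: "s > 0" "t > 0" by auto
  have "(\<Sum>i<M. \<Sum>l<M. x i * y l / (real i + real l + 1))
      = (s * t) * (\<Sum>i<M. \<Sum>l<M. (x i / s) * (y l / t) / (real i + real l + 1))"
    using pos by (simp add: sum_distrib_left)
  also have "\<dots> \<le> (s * t) * (pi / 2 * ((\<Sum>i<M. (x i / s)\<^sup>2) + (\<Sum>l<M. (y l / t)\<^sup>2)))"
    using x y pos by (intro mult_left_mono hilbert_ineq_sum) auto
  also have "\<dots> \<le> (s * t) * (pi / 2 * (1 + 1))"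
    using pos xs yt
    by (intro mult_left_mono add_mono) (auto simp: power_divide sum_divide_distrib[symmetric])
  finally show ?thesis by (simp add: algebra_simps)
qed

section \<open>Power series with square summable coefficients\<close>

text \<open>
  Norm bounds are kept as bounds of all partial sums of coefficients, so no convergence has to be
  discussed until the series is applied to an operator.
\<close>
definition l2_le :: "complex fps \<Rightarrow> real \<Rightarrow> bool" where
  "l2_le f s \<longleftrightarrow> 0 \<le> s \<and> (\<forall>M. (\<Sum>m<M. (cmod (fps_nth f m))\<^sup>2) \<le> s\<^sup>2)"

text \<open>
  The power series of \<open>1 / (1 - a * x)\<close>.
\<close>
definition geo :: "complex \<Rightarrow> complex fps" where
  "geo a = Abs_fps (\<lambda>m. a ^ m)"

text \<open>
  The power series of the Blaschke factor \<open>(x - a) / (1 - cnj a * x)\<close>.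
\<close>
definition blaschke :: "complex \<Rightarrow> complex fps" where
  "blaschke a = (fps_X - fps_const a) * geo (cnj a)"

lemma geo_nth: "fps_nth (geo a) m = a ^ m"
  by (simp add: geo_def)

lemma geo_inverse: "(1 - fps_const a * fps_X) * geo a = 1"
proof (rule fps_ext)
  fix m
  show "fps_nth ((1 - fps_const a * fps_X) * geo a) m = fps_nth 1 m"
    by (cases m) (simp_all add: geo_def left_diff_distrib mult.assoc)
qed

lemma geo_mult_nth:
  "fps_nth (geo a * q) 0 = fps_nth q 0"
  "fps_nth (geo a * q) (Suc m) = fps_nth q (Suc m) + a * fps_nth (geo a * q) m"
proof -
  have q: "q = geo a * q - fps_const a * (fps_X * (geo a * q))"
    using geo_inverse[of a] by (metis (no_types, lifting) left_diff_distrib mult.assoc mult_1)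
  show "fps_nth (geo a * q) 0 = fps_nth q 0"
    by (subst (2) q) simp
  show "fps_nth (geo a * q) (Suc m) = fps_nth q (Suc m) + a * fps_nth (geo a * q) m"
    by (subst (2) q) simp
qed

text \<open>
  For \<open>cmod a < 1\<close> multiplication by the Blaschke factor of \<open>a\<close> is an isometry of the Hardy space, and its range
  is orthogonal to the reproducing kernel \<open>geo (cnj a)\<close>; so the squared norms of the two summands add up.
  For coefficients this is elementary: with a suitable sequence \<open>U\<close> the coefficients of the left-hand
  side are \<open>U m - a * U (m + 1)\<close>, those of \<open>q\<close> are \<open>U (m + 1) - cnj a * U m\<close>, and the difference of the
  squared moduli telescopes.
\<close>
lemma l2_le_blaschke_step:
  assumes a: "cmod a < 1" and q: "l2_le q s"
  shows "l2_le (fps_const c * geo (cnj a) + blaschke a * q) (sqrt ((cmod c)\<^sup>2 / (1 - (cmod a)\<^sup>2) + s\<^sup>2))"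
proof -
  define x where "x = (cmod a)\<^sup>2"
  have x: "x < 1" using a unfolding x_def by (simp add: abs_square_less_1)
  define k where "k = c / of_real (1 - x)"
  have kc: "c = k * of_real (1 - x)" using x by (simp add: k_def)
  define p where "p = geo (cnj a) * q"
  define h where "h = fps_const c * geo (cnj a) + blaschke a * q"
  define P where "P = (\<lambda>m. case m of 0 \<Rightarrow> 0 | Suc j \<Rightarrow> fps_nth p j)"
  \<comment> \<open>\<open>P\<close> is \<open>p\<close> shifted by one place; adding a multiple of the powers of \<open>cnj a\<close> accounts for the kernel term of \<open>h\<close>.\<close>
  define U where "U = (\<lambda>m. P m + k * cnj a ^ m)"
  have ax: "a * cnj a = of_real x"
    unfolding x_def by (rule complex_norm_square[symmetric])
  have qU: "fps_nth q m = U (Suc m) - cnj a * U m" for m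
    by (cases m) (simp_all add: U_def P_def p_def geo_nth geo_mult_nth(2) right_diff_distrib distrib_left mult.left_commute)
  have "blaschke a * q = fps_X * p - fps_const a * p"
    by (simp add: blaschke_def p_def algebra_simps)
  then have bq: "fps_nth (blaschke a * q) m = P m - a * fps_nth p m" for m
    by (cases m) (simp_all add: P_def)
  have hU: "fps_nth h m = U m - a * U (Suc m)" for m
  proof -
    have "c * cnj a ^ m = k * cnj a ^ m - a * (k * cnj a ^ Suc m)"
      by (simp add: kc ax[symmetric] algebra_simps)
    moreover have "P (Suc m) = fps_nth p m"
      by (simp add: P_def)
    ultimately show ?thesis
      by (simp add: h_def bq geo_nth U_def distrib_left)
  qed
  have step: "(cmod (fps_nth h m))\<^sup>2 = (cmod (fps_nth q m))\<^sup>2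
      + (1 - x) * ((cmod (U m))\<^sup>2 - (cmod (U (Suc m)))\<^sup>2)" for m
    unfolding hU qU x_def cmod_power2
    by (simp add: power2_eq_square algebra_simps)
  have ident: "(\<Sum>m<M. (cmod (fps_nth h m))\<^sup>2)
      = (cmod c)\<^sup>2 / (1 - x) + (\<Sum>m<M. (cmod (fps_nth q m))\<^sup>2) - (1 - x) * (cmod (U M))\<^sup>2" for M
  proof (induction M)
    case 0
    have "(cmod c)\<^sup>2 = (1 - x)\<^sup>2 * (cmod k)\<^sup>2"
      using x by (simp add: kc norm_mult power_mult_distrib del: of_real_diff)
    then show ?case using x by (simp add: U_def P_def power2_eq_square)
  next
    case (Suc M)
    then show ?case by (simp add: step algebra_simps)
  qed
  show ?thesis
    unfolding l2_le_def h_def[symmetric]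
  proof (intro conjI allI)
    show "0 \<le> sqrt ((cmod c)\<^sup>2 / (1 - (cmod a)\<^sup>2) + s\<^sup>2)"
      using x by (simp add: x_def)
    fix M
    have "(\<Sum>m<M. (cmod (fps_nth h m))\<^sup>2) \<le> (cmod c)\<^sup>2 / (1 - x) + s\<^sup>2"
    proof -
      have "(\<Sum>m<M. (cmod (fps_nth q m))\<^sup>2) \<le> s\<^sup>2" using q by (simp add: l2_le_def)
      moreover have "0 \<le> (1 - x) * (cmod (U M))\<^sup>2" using x by simp
      ultimately show ?thesis using ident[of M] by linarith
    qed
    then show "(\<Sum>m<M. (cmod (fps_nth h m))\<^sup>2) \<le> (sqrt ((cmod c)\<^sup>2 / (1 - (cmod a)\<^sup>2) + s\<^sup>2))\<^sup>2"
      using x by (simp add: x_def)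
  qed
qed

lemma l2_le_const_mult:
  assumes "l2_le f s"
  shows "l2_le (fps_const c * f) (cmod c * s)"
  using assms
  by (auto simp: l2_le_def norm_mult power_mult_distrib sum_distrib_left[symmetric] intro!: mult_left_mono)

lemma l2_le_mono: "l2_le f s \<Longrightarrow> s \<le> t \<Longrightarrow> l2_le f t"
  unfolding l2_le_def by (meson order_trans power_mono)

lemma l2_le_zero: "l2_le 0 0"
  by (simp add: l2_le_def)

lemma l2_le_blaschke_mult: "cmod a < 1 \<Longrightarrow> l2_le q s \<Longrightarrow> l2_le (blaschke a * q) s"
  using l2_le_blaschke_step[of a q s 0] by (simp add: l2_le_def)

lemma l2_le_geo:
  assumes "cmod a < 1"
  shows "l2_le (geo a) (1 / sqrt (1 - (cmod a)\<^sup>2))"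
  using l2_le_blaschke_step[of "cnj a" 0 0 1] assms l2_le_zero by (simp add: real_sqrt_divide)

lemma geo_square_nth: "fps_nth ((geo a)\<^sup>2) m = of_nat (Suc m) * a ^ m"
proof -
  have "fps_nth ((geo a)\<^sup>2) m = (\<Sum>i=0..m. a ^ m)"
    unfolding power2_eq_square fps_mult_nth
    by (intro sum.cong) (auto simp: geo_def power_add[symmetric])
  then show ?thesis by simp
qed

text \<open>
  The squared norm is \<open>\<Sum>m. (m + 1)\<^sup>2 * x ^ m\<close> with \<open>x = (cmod a)\<^sup>2\<close>, whose partial sums have a closed
  form.
\<close>
lemma l2_le_geo_square:
  assumes a: "cmod a < 1"
  shows "l2_le ((geo a)\<^sup>2) (sqrt (2 / (1 - (cmod a)\<^sup>2) ^ 3))"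
proof -
  define x where "x = (cmod a)\<^sup>2"
  have x: "0 \<le> x" "x < 1" using a unfolding x_def by (simp_all add: abs_square_less_1)
  have ident: "(\<Sum>m<M. (real m + 1)\<^sup>2 * x ^ m) * (1 - x) ^ 3
     = 1 + x - x ^ M * ((real M + 1 - real M * x)\<^sup>2 + x)" for M
  proof (induction M)
    case (Suc M)
    define r where "r = real M"
    have r: "real (Suc M) = r + 1"
      by (simp add: r_def)
    have "(r + 1)\<^sup>2 * (1 - x) ^ 3 = ((r + 1 - r * x)\<^sup>2 + x) - x * ((r + 1 + 1 - (r + 1) * x)\<^sup>2 + x)"
      by (simp add: power2_eq_square power3_eq_cube algebra_simps)
    then have "x ^ M * ((r + 1)\<^sup>2 * (1 - x) ^ 3)
        = x ^ M * (((r + 1 - r * x)\<^sup>2 + x) - x * ((r + 1 + 1 - (r + 1) * x)\<^sup>2 + x))"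
      by simp
    moreover have "(\<Sum>m<Suc M. (real m + 1)\<^sup>2 * x ^ m) * (1 - x) ^ 3
        = (\<Sum>m<M. (real m + 1)\<^sup>2 * x ^ m) * (1 - x) ^ 3 + x ^ M * ((r + 1)\<^sup>2 * (1 - x) ^ 3)"
      by (simp add: r_def distrib_right)
    ultimately show ?case
      using Suc.IH unfolding r by (simp add: r_def[symmetric] right_diff_distrib mult_ac)
  qed simp
  have "(\<Sum>m<M. (cmod (fps_nth ((geo a)\<^sup>2) m))\<^sup>2) \<le> 2 / (1 - x) ^ 3" for M
  proof -
    have "(cmod (fps_nth ((geo a)\<^sup>2) m))\<^sup>2 = (real m + 1)\<^sup>2 * x ^ m" for m
    proof -
      have "cmod (fps_nth ((geo a)\<^sup>2) m) = (real m + 1) * cmod a ^ m"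
        unfolding geo_square_nth norm_mult norm_power norm_of_nat by simp
      then show ?thesis
        by (simp add: power_mult_distrib x_def power_mult[symmetric] mult.commute)
    qed
    moreover have "(\<Sum>m<M. (real m + 1)\<^sup>2 * x ^ m) * (1 - x) ^ 3 \<le> 2"
    proof -
      have "0 \<le> x ^ M * ((real M + 1 - real M * x)\<^sup>2 + x)" using x by simp
      then show ?thesis unfolding ident using x by linarith
    qed
    ultimately show ?thesis using x by (simp add: field_simps)
  qed
  then show ?thesis using x by (simp add: l2_le_def x_def)
qed

section \<open>Hardy's inequality for sums of products\<close>

text \<open>
  A bound for the norm of the Hardy space \<open>H\<^sup>1\<close> in the shape in which it is used: \<open>g\<close> is a finite sum
  of products of two square summable series, and \<open>s\<close> is the sum of the products of their norms.
  Working with such a factorization makes Hardy's inequality a consequence of Hilbert's, without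
  integrals over the circle.
\<close>
inductive h1_le :: "complex fps \<Rightarrow> real \<Rightarrow> bool" where
  zero: "h1_le 0 0"
| add: "h1_le g s \<Longrightarrow> l2_le u a \<Longrightarrow> l2_le v b \<Longrightarrow> h1_le (g + u * v) (s + a * b)"

lemma h1_le_blaschke_mult:
  assumes "h1_le g s" "cmod a < 1" "cmod c \<le> 1"
  shows "h1_le (fps_const c * blaschke a * g) s"
  using assms(1)
proof induction
  case zero
  then show ?case by (simp add: h1_le.zero)
next
  case (add g s u p v b)
  have "l2_le (fps_const c * (blaschke a * u)) (cmod c * p)"
    by (intro l2_le_const_mult l2_le_blaschke_mult add assms)
  moreover have "cmod c * p \<le> p"
    using assms(3) add(2) by (simp add: l2_le_def mult_left_le_one_le)
  ultimately have "l2_le (fps_const c * (blaschke a * u)) p"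
    by (rule l2_le_mono)
  from h1_le.add[OF add(4) this add(3)]
  show ?case by (simp add: algebra_simps)
qed

text \<open>
  The coefficients of a product are sums over \<open>i + l = m\<close>, so dividing by \<open>m + 1\<close> and summing produces
  part of the double sum in Hilbert's inequality.
\<close>
lemma hardy_ineq:
  assumes "h1_le g s"
  shows "(\<Sum>m<M. cmod (fps_nth g m) / (real m + 1)) \<le> pi * s"
  using assms
proof induction
  case (add g s u a v b)
  define x where "x = (\<lambda>i. cmod (fps_nth u i))"
  define y where "y = (\<lambda>i. cmod (fps_nth v i))"
  have "(\<Sum>m<M. cmod (fps_nth (u * v) m) / (real m + 1)) \<le>
      (\<Sum>m<M. \<Sum>i\<le>m. x i * y (m - i) / (real i + real (m - i) + 1))"
  proof (rule sum_mono)
    fix m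
    have "cmod (fps_nth (u * v) m) \<le> (\<Sum>i\<le>m. x i * y (m - i))"
      unfolding fps_mult_nth x_def y_def norm_mult[symmetric] atLeast0AtMost by (rule norm_sum)
    then have "cmod (fps_nth (u * v) m) / (real m + 1) \<le> (\<Sum>i\<le>m. x i * y (m - i)) / (real m + 1)"
      by (intro divide_right_mono) auto
    also have "\<dots> = (\<Sum>i\<le>m. x i * y (m - i) / (real i + real (m - i) + 1))"
      unfolding sum_divide_distrib by (intro sum.cong) (auto simp: of_nat_diff)
    finally show "cmod (fps_nth (u * v) m) / (real m + 1) \<le> \<dots>" .
  qed
  also have "\<dots> = (\<Sum>(i, l) \<in> {(i, l). i + l < M}. x i * y l / (real i + real l + 1))"
    by (rule sum.triangle_reindex[symmetric])
  also have "\<dots> \<le> (\<Sum>(i, l) \<in> {..<M} \<times> {..<M}. x i * y l / (real i + real l + 1))"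
    by (rule sum_mono2) (auto simp: x_def y_def)
  also have "\<dots> = (\<Sum>i<M. \<Sum>l<M. x i * y l / (real i + real l + 1))"
    by (simp add: sum.cartesian_product)
  also have "\<dots> \<le> pi * (a * b)"
    using add(2,3) by (intro hilbert_ineq) (auto simp: x_def y_def l2_le_def)
  finally have 1: "(\<Sum>m<M. cmod (fps_nth (u * v) m) / (real m + 1)) \<le> pi * (a * b)" .
  have "(\<Sum>m<M. cmod (fps_nth (g + u * v) m) / (real m + 1)) \<le>
     (\<Sum>m<M. cmod (fps_nth g m) / (real m + 1) + cmod (fps_nth (u * v) m) / (real m + 1))"
    unfolding add_divide_distrib[symmetric]
    by (intro sum_mono divide_right_mono) (auto simp: norm_triangle_ineq)
  also have "\<dots> = (\<Sum>m<M. cmod (fps_nth g m) / (real m + 1)) + (\<Sum>m<M. cmod (fps_nth (u * v) m) / (real m + 1))"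
    by (rule sum.distrib)
  finally show ?case using add(4) 1 by (simp add: algebra_simps)
qed auto

section \<open>The interpolating function\<close>

lemma fps_deriv_geo: "fps_deriv (geo a) = fps_const a * (geo a)\<^sup>2"
proof (rule fps_ext)
  fix m
  show "fps_nth (fps_deriv (geo a)) m = fps_nth (fps_const a * (geo a)\<^sup>2) m"
    by (simp add: geo_nth geo_square_nth del: of_nat_Suc)
qed

lemma fps_deriv_blaschke:
  "fps_deriv (blaschke a) = fps_const (1 - a * cnj a) * (geo (cnj a))\<^sup>2"
proof -
  let ?G = "geo (cnj a)"
  have "fps_deriv (blaschke a) = ?G + (fps_X - fps_const a) * (fps_const (cnj a) * ?G\<^sup>2)"
    by (simp add: blaschke_def fps_deriv_geo)
  also have "?G + (fps_X - fps_const a) * (fps_const (cnj a) * ?G\<^sup>2)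
     = ((1 - fps_const (cnj a) * fps_X) * ?G) * ?G + (fps_X - fps_const a) * (fps_const (cnj a) * ?G\<^sup>2)"
    unfolding geo_inverse by simp
  also have "\<dots> = (1 - fps_const a * fps_const (cnj a)) * ?G\<^sup>2"
    by (simp add: algebra_simps power2_eq_square)
  also have "1 - fps_const a * fps_const (cnj a) = fps_const (1 - a * cnj a)"
    by (metis fps_const_1_eq_1 fps_const_mult fps_const_sub)
  finally show ?thesis .
qed

text \<open>
  For \<open>L\<close> with Blaschke product \<open>B\<close> this is the power series of \<open>(1 - B x / B z) / (z - x)\<close>: the function
  that interpolates the resolvent \<open>1 / (z - x)\<close> at the points of \<open>L\<close> (with multiplicity). The recursion peels off one Blaschke factor; the scalar
  \<open>(1 - cnj a * z) / (z - a)\<close> is the reciprocal of the value of that factor at \<open>z\<close>, written so that it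
  makes sense also when \<open>z\<close> is the pole of the factor.
\<close>
fun interp :: "complex \<Rightarrow> complex list \<Rightarrow> complex fps" where
  "interp z [] = 0"
| "interp z (a # L) = fps_const ((1 - a * cnj a) / (z - a)) * geo (cnj a)
     + fps_const ((1 - cnj a * z) / (z - a)) * blaschke a * interp z L"

text \<open>
  What remains of \<open>B x / B z\<close> after the polynomial \<open>\<Prod>a\<leftarrow>L. (x - a)\<close> has been split off.
\<close>
fun cofactor :: "complex \<Rightarrow> complex list \<Rightarrow> complex fps" where
  "cofactor z [] = 1"
| "cofactor z (a # L) = fps_const ((1 - cnj a * z) / (z - a)) * geo (cnj a) * cofactor z L"

text \<open>
  With \<open>b\<close> the Blaschke factor of \<open>a\<close> one has \<open>1 - b x / b z = (z - x) * c / (1 - cnj a * x)\<close> for the constant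
  \<open>c = (1 - a * cnj a) / (z - a)\<close>, so the terms added in the recursion telescope.
\<close>
lemma interp_identity:
  assumes "z \<notin> set L"
  shows "(fps_const z - fps_X) * interp z L = 1 - (\<Prod>a\<leftarrow>L. fps_X - fps_const a) * cofactor z L"
  using assms
proof (induction L)
  case (Cons a L)
  have IH: "(fps_const z - fps_X) * interp z L = 1 - (\<Prod>a\<leftarrow>L. fps_X - fps_const a) * cofactor z L"
    using Cons by simp
  define c b where "c = (1 - a * cnj a) / (z - a)" and "b = (1 - cnj a * z) / (z - a)"
  have za: "z - a \<noteq> 0" using Cons.prems by auto
  have "z * c - b * a = (z * (1 - a * cnj a) - (1 - cnj a * z) * a) / (z - a)"
    unfolding c_def b_def times_divide_eq_right times_divide_eq_left diff_divide_distrib[symmetric] ..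
  also have "z * (1 - a * cnj a) - (1 - cnj a * z) * a = z - a"
    by (simp add: algebra_simps)
  finally have 1: "z * c - b * a = 1" using za by simp
  have "b - c = ((1 - cnj a * z) - (1 - a * cnj a)) / (z - a)"
    by (simp add: c_def b_def diff_divide_distrib)
  also have "(1 - cnj a * z) - (1 - a * cnj a) = - cnj a * (z - a)"
    by (simp add: algebra_simps)
  finally have 2: "b - c = - cnj a" using za by simp
  have "(fps_const z - fps_X) * fps_const c + fps_const b * (fps_X - fps_const a)
     = fps_const (z * c - b * a) + fps_const (b - c) * fps_X"
    by (simp add: algebra_simps flip: fps_const_sub fps_const_mult)
  also have "\<dots> = 1 - fps_const (cnj a) * fps_X"
    unfolding 1 2 by (simp flip: fps_const_neg)
  finally have 3: "((fps_const z - fps_X) * fps_const c + fps_const b * (fps_X - fps_const a)) * geo (cnj a) = 1"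
    by (simp add: geo_inverse)
  have "(fps_const z - fps_X) * interp z (a # L) =
     (fps_const z - fps_X) * fps_const c * geo (cnj a) +
      fps_const b * blaschke a * ((fps_const z - fps_X) * interp z L)"
    by (simp add: c_def b_def algebra_simps)
  also have "\<dots> = ((fps_const z - fps_X) * fps_const c + fps_const b * (fps_X - fps_const a)) * geo (cnj a)
     - fps_const b * blaschke a * ((\<Prod>a\<leftarrow>L. fps_X - fps_const a) * cofactor z L)"
    unfolding IH by (simp add: blaschke_def algebra_simps)
  also have "\<dots> = 1 - (\<Prod>a\<leftarrow>a # L. fps_X - fps_const a) * cofactor z (a # L)"
    unfolding 3 by (simp add: b_def blaschke_def mult_ac)
  finally show ?case .
qed simp

text \<open>
  The Blaschke factor maps the exterior of the disc to the exterior of the disc; this is where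
  \<open>cmod z \<ge> 1\<close> enters.
\<close>
lemma reflected_factor_le_1:
  assumes "cmod a < 1" "1 \<le> cmod z"
  shows "cmod ((1 - cnj a * z) / (z - a)) \<le> 1"
proof -
  have za: "z \<noteq> a" using assms by auto
  have "(cmod (z - a))\<^sup>2 - (cmod (1 - cnj a * z))\<^sup>2 = ((cmod z)\<^sup>2 - 1) * (1 - (cmod a)\<^sup>2)"
    unfolding cmod_power2 by (simp add: power2_eq_square algebra_simps)
  also have "\<dots> \<ge> 0"
    using assms by (intro mult_nonneg_nonneg) (auto simp: abs_square_le_1 one_le_power)
  finally have "(cmod (1 - cnj a * z))\<^sup>2 \<le> (cmod (z - a))\<^sup>2" by simp
  then have "cmod (1 - cnj a * z) \<le> cmod (z - a)"
    by (rule power2_le_imp_le) simp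
  then show ?thesis using za by (simp add: norm_divide)
qed

lemma one_minus_cnj: "1 - a * cnj a = of_real (1 - (cmod a)\<^sup>2)"
  by (simp add: complex_norm_square[symmetric])

locale interpolation =
  fixes z :: complex and d :: real
  assumes z: "1 \<le> cmod z" and d: "0 < d"
begin

text \<open>
  By the orthogonality in the recursion, the squared norm is at most the sum of the squared norms
  of the multiples of reproducing kernels that are added.
\<close>
lemma l2_le_interp:
  assumes "\<And>a. a \<in> set L \<Longrightarrow> cmod a < 1 \<and> d \<le> cmod (z - a)"
  shows "l2_le (interp z L) (sqrt (\<Sum>a\<leftarrow>L. 1 - (cmod a)\<^sup>2) / d)"
  using assms
proof (induction L)
  case Nil
  then show ?case by (simp add: l2_le_zero)
next
  case (Cons a L)
  define S where "S = (\<Sum>a\<leftarrow>L. 1 - (cmod a)\<^sup>2)"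
  have a: "cmod a < 1" "d \<le> cmod (z - a)" using Cons.prems by auto
  have x: "(cmod a)\<^sup>2 < 1" using a by (simp add: abs_square_less_1)
  have S: "0 \<le> S"
    unfolding S_def using Cons.prems
    by (intro sum_list_nonneg) (auto simp: abs_square_le_1 less_imp_le)
  let ?c = "(1 - a * cnj a) / (z - a)" and ?b = "(1 - cnj a * z) / (z - a)"
  have "l2_le (fps_const ?b * interp z L) (cmod ?b * (sqrt S / d))"
    unfolding S_def by (intro l2_le_const_mult Cons) auto
  moreover have "cmod ?b * (sqrt S / d) \<le> sqrt S / d"
    using reflected_factor_le_1[OF a(1) z] d S by (intro mult_left_le_one_le) auto
  ultimately have "l2_le (fps_const ?b * interp z L) (sqrt S / d)"
    by (rule l2_le_mono)
  from l2_le_blaschke_step[OF a(1) this, of ?c]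
  have "l2_le (interp z (a # L)) (sqrt ((cmod ?c)\<^sup>2 / (1 - (cmod a)\<^sup>2) + (sqrt S / d)\<^sup>2))"
    by (simp add: mult_ac)
  moreover have "sqrt ((cmod ?c)\<^sup>2 / (1 - (cmod a)\<^sup>2) + (sqrt S / d)\<^sup>2) \<le> sqrt (1 - (cmod a)\<^sup>2 + S) / d"
  proof -
    have "cmod ?c = (1 - (cmod a)\<^sup>2) / cmod (z - a)"
      unfolding one_minus_cnj norm_divide norm_of_real using x by simp
    also have "\<dots> \<le> (1 - (cmod a)\<^sup>2) / d"
      using a d x by (intro divide_left_mono) (auto intro!: mult_pos_pos)
    finally have "(cmod ?c)\<^sup>2 \<le> ((1 - (cmod a)\<^sup>2) / d)\<^sup>2"
      by (intro power_mono) auto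
    then have "(cmod ?c)\<^sup>2 / (1 - (cmod a)\<^sup>2) \<le> ((1 - (cmod a)\<^sup>2) / d)\<^sup>2 / (1 - (cmod a)\<^sup>2)"
      using x by (intro divide_right_mono) auto
    also have "\<dots> = (1 - (cmod a)\<^sup>2) / d\<^sup>2"
      using x by (simp add: power_divide power2_eq_square[of "1 - (cmod a)\<^sup>2"])
    finally have "(cmod ?c)\<^sup>2 / (1 - (cmod a)\<^sup>2) + (sqrt S / d)\<^sup>2 \<le> (1 - (cmod a)\<^sup>2 + S) / d\<^sup>2"
      using S by (simp add: power_divide add_divide_distrib)
    then have "sqrt ((cmod ?c)\<^sup>2 / (1 - (cmod a)\<^sup>2) + (sqrt S / d)\<^sup>2) \<le> sqrt ((1 - (cmod a)\<^sup>2 + S) / d\<^sup>2)"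
      by simp
    then show ?thesis using d by (simp add: real_sqrt_divide)
  qed
  ultimately show ?case
    by (simp add: S_def l2_le_mono)
qed

text \<open>
  The product rule for the recursion gives three terms. One is the derivative for the tail times a
  Blaschke factor, which preserves the bound. One is a product of two geometric series, and costs at
  most \<open>1 / d\<close>. The last is \<open>(1 - x) * (geo (cnj a))\<^sup>2 * interp z L\<close> with \<open>x = (cmod a)\<^sup>2\<close>, up to a factor of modulus at
  most 1: the norm of its first part is at most \<open>sqrt (2 / (1 - x))\<close>, unbounded as \<open>a\<close> approaches the circle.
  The order of the list compensates for it: all points of \<open>L\<close> are at least as close to the circle as \<open>a\<close>, so
  the norm of the second part is at most \<open>sqrt (length L * (1 - x)) / d\<close>.
\<close>
lemma h1_le_deriv_interp:
  assumes "\<And>a. a \<in> set L \<Longrightarrow> cmod a < 1 \<and> d \<le> cmod (z - a)"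
    and "sorted_wrt (\<lambda>a b. cmod a \<le> cmod b) L"
  shows "\<exists>s \<le> (\<Sum>m<length L. 1 + sqrt (2 * real m)) / d. h1_le (fps_deriv (interp z L)) s"
  using assms
proof (induction L)
  case Nil
  then show ?case by (auto intro: h1_le.zero)
next
  case (Cons a L)
  define x where "x = (cmod a)\<^sup>2"
  have a: "cmod a < 1" "d \<le> cmod (z - a)" using Cons.prems by auto
  have x: "0 \<le> x" "x < 1" using a by (simp_all add: x_def abs_square_less_1)
  define c b where "c = (1 - a * cnj a) / (z - a)" and "b = (1 - cnj a * z) / (z - a)"
  have b: "cmod b \<le> 1" unfolding b_def by (rule reflected_factor_le_1[OF a(1) z])
  obtain s where s: "s \<le> (\<Sum>m<length L. 1 + sqrt (2 * real m)) / d" "h1_le (fps_deriv (interp z L)) s"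
    using Cons by auto
  let ?G = "geo (cnj a)"
  define e where "e = 1 - a * cnj a"
  have "interp z (a # L) = fps_const c * ?G + fps_const b * blaschke a * interp z L"
    by (simp add: c_def b_def)
  then have deriv: "fps_deriv (interp z (a # L)) =
      (fps_const b * blaschke a * fps_deriv (interp z L)
       + (fps_const (c * cnj a) * ?G) * ?G)
       + (fps_const (b * e) * ?G\<^sup>2) * interp z L"
    by (simp add: fps_deriv_geo fps_deriv_blaschke e_def[symmetric]
        power2_eq_square algebra_simps flip: fps_const_mult)
  have G: "l2_le ?G (1 / sqrt (1 - x))"
    using l2_le_geo[of "cnj a"] a by (simp add: x_def)
  have G2: "l2_le (?G\<^sup>2) (sqrt (2 / (1 - x) ^ 3))"
    using l2_le_geo_square[of "cnj a"] a by (simp add: x_def)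
  have nrm: "cmod e = 1 - x"
    unfolding e_def one_minus_cnj norm_of_real using x by (simp add: x_def)
  define A where "A = cmod (c * cnj a) * (1 / sqrt (1 - x))"
  define B where "B = cmod (b * e) * sqrt (2 / (1 - x) ^ 3)"
  define E where "E = sqrt (\<Sum>a\<leftarrow>L. 1 - (cmod a)\<^sup>2) / d"
  have E: "l2_le (interp z L) E"
    unfolding E_def using Cons.prems by (intro l2_le_interp) auto
  have "h1_le (fps_deriv (interp z (a # L))) ((s + A * (1 / sqrt (1 - x))) + B * E)"
    unfolding deriv A_def B_def
    by (intro h1_le.add l2_le_const_mult G G2 E h1_le_blaschke_mult s a b)
  moreover have "(s + A * (1 / sqrt (1 - x))) + B * E \<le> (\<Sum>m<length (a # L). 1 + sqrt (2 * real m)) / d"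
  proof -
    have "A * (1 / sqrt (1 - x)) = cmod (c * cnj a) * (1 / sqrt (1 - x) * (1 / sqrt (1 - x)))"
      by (simp add: A_def)
    also have "1 / sqrt (1 - x) * (1 / sqrt (1 - x)) = 1 / (1 - x)"
      using x by simp
    also have "cmod (c * cnj a) * (1 / (1 - x)) = cmod a * (1 / cmod (z - a))"
      using x by (simp add: c_def e_def[symmetric] norm_mult norm_divide nrm)
    also have "\<dots> \<le> 1 * (1 / d)"
      using a d by (intro mult_mono divide_left_mono) (auto intro!: mult_pos_pos)
    finally have 1: "A * (1 / sqrt (1 - x)) \<le> 1 / d" by simp
    have "E \<le> sqrt (real (length L) * (1 - x)) / d"
    proof -
      have "1 - (cmod a')\<^sup>2 \<le> 1 - x" if "a' \<in> set L" for a'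
        using Cons.prems(2) that by (auto simp: x_def intro!: power_mono)
      then have "(\<Sum>a\<leftarrow>L. 1 - (cmod a)\<^sup>2) \<le> (\<Sum>a\<leftarrow>L. 1 - x)"
        by (rule sum_list_mono)
      then show ?thesis
        unfolding E_def using d by (intro divide_right_mono) (auto simp: sum_list_triv)
    qed
    moreover have "B \<le> (1 - x) * sqrt (2 / (1 - x) ^ 3)"
      unfolding B_def norm_mult nrm using b x by (intro mult_right_mono mult_left_le_one_le) auto
    ultimately have "B * E \<le> ((1 - x) * sqrt (2 / (1 - x) ^ 3)) * (sqrt (real (length L) * (1 - x)) / d)"
      using x E by (intro mult_mono) (auto simp: l2_le_def)
    also have "\<dots> = (sqrt ((1 - x)\<^sup>2) * sqrt (2 / (1 - x) ^ 3) * sqrt (real (length L) * (1 - x))) / d"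
      using x by simp
    also have "\<dots> = sqrt ((1 - x)\<^sup>2 * (2 / (1 - x) ^ 3) * (real (length L) * (1 - x))) / d"
      unfolding real_sqrt_mult ..
    also have "(1 - x)\<^sup>2 * (2 / (1 - x) ^ 3) * (real (length L) * (1 - x)) = 2 * real (length L)"
      using x by (simp add: power2_eq_square power3_eq_cube)
    finally have 2: "B * E \<le> sqrt (2 * real (length L)) / d" .
    show ?thesis
      using s(1) 1 2 by (simp add: add_divide_distrib)
  qed
  ultimately show ?case by blast
qed

end

lemma sum_sqrt_le: "(\<Sum>m<n. sqrt (real m)) \<le> 2/3 * real n * sqrt (real n)"
proof (induction n)
  case (Suc n)
  define a where "a = sqrt (real n)"
  define b where "b = sqrt (real (Suc n))"
  have a: "a \<ge> 0" "real n = a\<^sup>2" and b: "b \<ge> 0" "b\<^sup>2 = a\<^sup>2 + 1"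
    by (simp_all add: a_def b_def)
  have "(a * (2 * a\<^sup>2 + 3))\<^sup>2 \<le> (2 * b\<^sup>2 * b)\<^sup>2"
  proof -
    have "(2 * b\<^sup>2 * b)\<^sup>2 = 4 * (b\<^sup>2) ^ 3"
      by (simp add: power2_eq_square power3_eq_cube)
    also have "\<dots> = (a * (2 * a\<^sup>2 + 3))\<^sup>2 + 3 * a\<^sup>2 + 4"
      unfolding b(2) by (simp add: power2_eq_square power3_eq_cube algebra_simps)
    finally show ?thesis by simp
  qed
  then have "a * (2 * a\<^sup>2 + 3) \<le> 2 * b\<^sup>2 * b"
    by (rule power2_le_imp_le) (use b(1) in auto)
  then have "2/3 * a\<^sup>2 * a + a \<le> 2/3 * (a\<^sup>2 + 1) * b"
    unfolding b(2) by (simp add: algebra_simps)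
  moreover have "real (Suc n) = a\<^sup>2 + 1" using a(2) by simp
  ultimately show ?case
    using Suc unfolding a_def[symmetric] b_def[symmetric] by (simp add: a b(1) algebra_simps)
qed simp

definition wiener_bound :: "nat \<Rightarrow> real" where
  "wiener_bound n = sqrt n + pi * (n + 2 * sqrt 2 / 3 * n * sqrt n)"

text \<open>
  Since \<open>(m + 1) * f\<^sub>m\<^sub>+\<^sub>1\<close> is the coefficient of the derivative, Hardy's inequality for the
  derivative bounds the sum of all coefficients but the constant one.
\<close>
lemma (in interpolation) wiener_norm_interp:
  assumes L: "\<And>a. a \<in> set L \<Longrightarrow> cmod a < 1 \<and> d \<le> cmod (z - a)"
    and sorted: "sorted_wrt (\<lambda>a b. cmod a \<le> cmod b) L"
  shows "(\<Sum>m<M. cmod (fps_nth (interp z L) m)) \<le> wiener_bound (length L) / d"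
proof -
  define n where "n = length L"
  define f where "f = interp z L"
  obtain s where s: "s \<le> (\<Sum>m<n. 1 + sqrt (2 * real m)) / d" "h1_le (fps_deriv f) s"
    using h1_le_deriv_interp[OF assms] by (auto simp: f_def n_def)
  have "(\<Sum>m<n. 1 + sqrt (2 * real m)) = real n + sqrt 2 * (\<Sum>m<n. sqrt (real m))"
    by (simp add: sum.distrib real_sqrt_mult sum_distrib_left)
  also have "\<dots> \<le> real n + sqrt 2 * (2/3 * real n * sqrt (real n))"
    by (intro add_left_mono mult_left_mono sum_sqrt_le) auto
  finally have "(\<Sum>m<n. 1 + sqrt (2 * real m)) / d \<le> (n + 2 * sqrt 2 / 3 * n * sqrt n) / d"
    using d by (intro divide_right_mono) (auto simp: mult_ac)
  with s(1) have s': "s \<le> (n + 2 * sqrt 2 / 3 * n * sqrt n) / d" by linarith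
  have "(\<Sum>a\<leftarrow>L. 1 - (cmod a)\<^sup>2) \<le> (\<Sum>a\<leftarrow>L. 1)"
    by (rule sum_list_mono) simp
  then have "sqrt (\<Sum>a\<leftarrow>L. 1 - (cmod a)\<^sup>2) / d \<le> sqrt (real n) / d"
    using d by (intro divide_right_mono) (auto simp: sum_list_triv n_def)
  then have "l2_le f (sqrt (real n) / d)"
    using l2_le_mono[OF l2_le_interp] L unfolding f_def by blast
  then have "(\<Sum>m<1. (cmod (fps_nth f m))\<^sup>2) \<le> (sqrt (real n) / d)\<^sup>2"
    unfolding l2_le_def by blast
  then have "(cmod (fps_nth f 0))\<^sup>2 \<le> (sqrt (real n) / d)\<^sup>2"
    by simp
  then have f0: "cmod (fps_nth f 0) \<le> sqrt (real n) / d"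
    by (rule power2_le_imp_le) (use d in auto)
  have "(\<Sum>m<M. cmod (fps_nth f m)) \<le> (\<Sum>m<Suc M. cmod (fps_nth f m))"
    by simp
  also have "\<dots> = cmod (fps_nth f 0) + (\<Sum>m<M. cmod (fps_nth f (Suc m)))"
    by (rule sum.lessThan_Suc_shift)
  also have "(\<Sum>m<M. cmod (fps_nth f (Suc m))) = (\<Sum>m<M. cmod (fps_nth (fps_deriv f) m) / (real m + 1))"
  proof (rule sum.cong[OF refl])
    fix m
    have "cmod (fps_nth (fps_deriv f) m) = (real m + 1) * cmod (fps_nth f (Suc m))"
      unfolding fps_deriv_nth norm_mult norm_of_nat by simp
    then show "cmod (fps_nth f (Suc m)) = cmod (fps_nth (fps_deriv f) m) / (real m + 1)"
      by simp
  qed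
  also have "cmod (fps_nth f 0) + \<dots> \<le> sqrt (real n) / d + pi * s"
    by (intro add_mono f0 hardy_ineq s)
  also have "\<dots> \<le> sqrt (real n) / d + pi * ((n + 2 * sqrt 2 / 3 * n * sqrt n) / d)"
    using s' by (intro add_mono mult_left_mono) auto
  also have "\<dots> = wiener_bound n / d"
    by (simp add: wiener_bound_def add_divide_distrib distrib_left)
  finally show ?thesis by (simp add: f_def n_def)
qed

section \<open>Absolutely summable power series\<close>

definition wiener :: "complex fps \<Rightarrow> bool" where
  "wiener f \<longleftrightarrow> summable (\<lambda>m. cmod (fps_nth f m))"

lemma wiener_mult:
  assumes "wiener f" "wiener g"
  shows "wiener (f * g)"
proof -
  have "summable (\<lambda>k. \<Sum>i\<le>k. cmod (fps_nth f i) * cmod (fps_nth g (k - i)))"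
    using assms unfolding wiener_def by (intro summable_Cauchy_product) auto
  moreover have "norm (cmod (fps_nth (f * g) m)) \<le> (\<Sum>i\<le>m. cmod (fps_nth f i) * cmod (fps_nth g (m - i)))" for m
  proof -
    have "cmod (fps_nth (f * g) m) \<le> (\<Sum>i\<le>m. cmod (fps_nth f i * fps_nth g (m - i)))"
      unfolding fps_mult_nth atLeast0AtMost by (rule norm_sum)
    then show ?thesis by (simp add: norm_mult)
  qed
  ultimately show ?thesis
    unfolding wiener_def by (rule summable_comparison_test')
qed

lemma wiener_const [simp]: "wiener (fps_const c)"
  unfolding wiener_def by (rule summable_finite[of "{0}"]) auto

lemma wiener_geo: "cmod a < 1 \<Longrightarrow> wiener (geo a)"
  unfolding wiener_def geo_nth norm_power by (intro summable_geometric) simp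

lemma wiener_cofactor:
  assumes "\<And>a. a \<in> set L \<Longrightarrow> cmod a < 1"
  shows "wiener (cofactor z L)"
  using assms
proof (induction L)
  case Nil
  then show ?case using wiener_const[of 1] by simp
qed (auto intro!: wiener_mult wiener_geo)

section \<open>Linear factors of a matrix and the Cayley-Hamilton theorem\<close>

text \<open>
  The vector \<open>(p + q S) w\<close>, corresponding to multiplication of a power series by \<open>p + q * x\<close>.
\<close>
definition affine_apply :: "complex mat \<Rightarrow> complex \<Rightarrow> complex \<Rightarrow> complex vec \<Rightarrow> complex vec" where
  "affine_apply S p q w = p \<cdot>\<^sub>v w + q \<cdot>\<^sub>v (S *\<^sub>v w)"

fun factors_apply :: "complex mat \<Rightarrow> complex list \<Rightarrow> complex vec \<Rightarrow> complex vec" where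
  "factors_apply S [] v = v"
| "factors_apply S (a # L) v = affine_apply S (- a) 1 (factors_apply S L v)"

lemma affine_apply_carrier: "S \<in> carrier_mat n n \<Longrightarrow> w \<in> carrier_vec n \<Longrightarrow> affine_apply S p q w \<in> carrier_vec n"
  by (simp add: affine_apply_def)

lemma factors_apply_carrier: "S \<in> carrier_mat n n \<Longrightarrow> w \<in> carrier_vec n \<Longrightarrow> factors_apply S L w \<in> carrier_vec n"
  by (induction L) (simp_all add: affine_apply_carrier)

text \<open>
  The factor of the last diagonal entry kills the last coordinate of any vector, the factor of the
  last but one then kills the last but one coordinate, and so on.
\<close>
lemma factors_apply_upper_triangular:
  assumes B: "B \<in> carrier_mat n n" "upper_triangular B" and v: "v \<in> carrier_vec n"
    and k: "k \<le> n" and i: "k \<le> i" "i < n"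
  shows "factors_apply B (drop k (diag_mat B)) v $ i = 0"
  using k i
proof (induction k arbitrary: i rule: inc_induct)
  case (step k)
  let ?u = "factors_apply B (drop (Suc k) (diag_mat B)) v"
  have u: "?u \<in> carrier_vec n" using factors_apply_carrier[OF B(1) v] .
  have len: "length (diag_mat B) = n" using B(1) by (simp add: diag_mat_def)
  have "drop k (diag_mat B) = diag_mat B ! k # drop (Suc k) (diag_mat B)"
    using step.hyps len by (simp add: Cons_nth_drop_Suc)
  moreover have "diag_mat B ! k = B $$ (k, k)"
    using B(1) step.hyps by (simp add: diag_mat_def)
  ultimately have eq: "factors_apply B (drop k (diag_mat B)) v = affine_apply B (- (B $$ (k, k))) 1 ?u"
    by simp
  have "(B *\<^sub>v ?u) $ i = (\<Sum>j = 0..<n. B $$ (i, j) * ?u $ j)"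
    using B(1) u step.prems by (simp add: scalar_prod_def)
  also have "\<dots> = (\<Sum>j = 0..<n. if j = i then B $$ (i, i) * ?u $ i else 0)"
  proof (rule sum.cong[OF refl])
    fix j assume j: "j \<in> {0..<n}"
    show "B $$ (i, j) * ?u $ j = (if j = i then B $$ (i, i) * ?u $ i else 0)"
    proof (cases j i rule: linorder_cases)
      case less
      then have "B $$ (i, j) = 0" using B step.prems by auto
      then show ?thesis using less by simp
    next
      case greater
      then have "?u $ j = 0" using step.prems step.IH j by auto
      then show ?thesis using greater by simp
    qed simp
  qed
  also have "\<dots> = B $$ (i, i) * ?u $ i"
    using step.prems by (simp add: sum.delta)
  finally have "factors_apply B (drop k (diag_mat B)) v $ i = (B $$ (i, i) - B $$ (k, k)) * ?u $ i"
    using u B(1) step.prems unfolding eq affine_apply_def by (simp add: algebra_simps del: index_mult_mat_vec)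
  also have "\<dots> = 0"
    using step.prems step.IH[of i] by (cases "i = k") auto
  finally show ?case .
qed simp

lemma factors_apply_similar:
  assumes S: "S \<in> carrier_mat n n" and sim: "similar_mat_wit S B P Q" and v: "v \<in> carrier_vec n"
  shows "factors_apply S L v = P *\<^sub>v factors_apply B L (Q *\<^sub>v v)"
proof (induction L)
  note w = similar_mat_witD2[OF S sim]
  case Nil
  have "P *\<^sub>v (Q *\<^sub>v v) = (P * Q) *\<^sub>v v"
    using assoc_mult_mat_vec[OF w(6,7) v] by simp
  then show ?case using w(1) v by simp
next
  note w = similar_mat_witD2[OF S sim]
  case (Cons a L)
  define u where "u = factors_apply B L (Q *\<^sub>v v)"
  have u: "u \<in> carrier_vec n"
    unfolding u_def using w v by (intro factors_apply_carrier) auto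
  have "S *\<^sub>v (P *\<^sub>v u) = (S * P) *\<^sub>v u"
    using assoc_mult_mat_vec[OF S w(6) u] by simp
  also have "S * P = P * B * (Q * P)"
    unfolding w(3) by (rule assoc_mult_mat) (use w in auto)
  also have "\<dots> = P * B"
    unfolding w(2) using w by (intro right_mult_one_mat) auto
  also have "(P * B) *\<^sub>v u = P *\<^sub>v (B *\<^sub>v u)"
    using w u by (intro assoc_mult_mat_vec) auto
  finally have SP: "S *\<^sub>v (P *\<^sub>v u) = P *\<^sub>v (B *\<^sub>v u)" .
  have "P *\<^sub>v affine_apply B (- a) 1 u = P *\<^sub>v ((- a) \<cdot>\<^sub>v u) + P *\<^sub>v (1 \<cdot>\<^sub>v (B *\<^sub>v u))"
    unfolding affine_apply_def using w u by (intro mult_add_distrib_mat_vec) auto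
  also have "P *\<^sub>v ((- a) \<cdot>\<^sub>v u) = (- a) \<cdot>\<^sub>v (P *\<^sub>v u)"
    using w u by (intro mult_mat_vec) auto
  also have "P *\<^sub>v (1 \<cdot>\<^sub>v (B *\<^sub>v u)) = 1 \<cdot>\<^sub>v (P *\<^sub>v (B *\<^sub>v u))"
    using w u by (intro mult_mat_vec) auto
  finally show ?case
    using Cons by (simp add: affine_apply_def SP u_def[symmetric])
qed

text \<open>
  A Schur decomposition exists for every order of the eigenvalues, so the triangular case applies to
  the list \<open>es\<close> as it is given.
\<close>
lemma cayley_hamilton:
  assumes S: "(S :: complex mat) \<in> carrier_mat n n"
    and char: "char_poly S = (\<Prod>e\<leftarrow>es. [:- e, 1:])" and v: "v \<in> carrier_vec n"
  shows "factors_apply S es v = 0\<^sub>v n"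
proof -
  obtain B P Q where B: "schur_decomposition S es = (B, P, Q)"
    by (cases "schur_decomposition S es") auto
  from schur_decomposition[OF S char B]
  have sim: "similar_mat_wit S B P Q" and ut: "upper_triangular B" and es: "diag_mat B = es" by auto
  note w = similar_mat_witD2[OF S sim]
  have Qv: "Q *\<^sub>v v \<in> carrier_vec n" using w v by auto
  have "factors_apply B es (Q *\<^sub>v v) = 0\<^sub>v n"
  proof (rule eq_vecI)
    fix i assume "i < dim_vec (0\<^sub>v n :: complex vec)"
    then show "factors_apply B es (Q *\<^sub>v v) $ i = 0\<^sub>v n $ i"
      using factors_apply_upper_triangular[OF w(5) ut Qv, of 0 i] es by simp
  qed (use factors_apply_carrier[OF w(5) Qv] in auto)
  then show ?thesis
    unfolding factors_apply_similar[OF S sim v] using w(6) by (intro eq_vecI) auto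
qed

section \<open>Functional calculus along an orbit\<close>

locale bounded_powers =
  fixes S :: "complex mat" and n :: nat and c :: real
  assumes S: "S \<in> carrier_mat n n" and bounded: "\<And>k. norm_bound (S ^\<^sub>m k) c"
begin

definition orbit :: "nat \<Rightarrow> complex vec \<Rightarrow> nat \<Rightarrow> complex" where
  "orbit i w m = ((S ^\<^sub>m m) *\<^sub>v w) $ i"

definition orbit_sum :: "nat \<Rightarrow> complex vec \<Rightarrow> complex fps \<Rightarrow> complex" where
  "orbit_sum i w f = (\<Sum>m. fps_nth f m * orbit i w m)"

lemma pow_Suc_vec: "w \<in> carrier_vec n \<Longrightarrow> (S ^\<^sub>m Suc m) *\<^sub>v w = (S ^\<^sub>m m) *\<^sub>v (S *\<^sub>v w)"
  using S by (simp add: assoc_mult_mat_vec[of _ n n _ n])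

lemma orbit_affine_apply:
  assumes "w \<in> carrier_vec n" "i < n"
  shows "orbit i (affine_apply S p q w) m = p * orbit i w m + q * orbit i w (Suc m)"
proof -
  have Sm: "S ^\<^sub>m m \<in> carrier_mat n n" using S by (rule pow_carrier_mat)
  have Sw: "S *\<^sub>v w \<in> carrier_vec n" using S assms by auto
  have "(S ^\<^sub>m m) *\<^sub>v affine_apply S p q w = p \<cdot>\<^sub>v ((S ^\<^sub>m m) *\<^sub>v w) + q \<cdot>\<^sub>v ((S ^\<^sub>m m) *\<^sub>v (S *\<^sub>v w))"
    unfolding affine_apply_def using Sm Sw assms(1)
    by (simp add: mult_add_distrib_mat_vec[OF Sm] mult_mat_vec[OF Sm])
  then show ?thesis
    unfolding orbit_def pow_Suc_vec[OF assms(1)] using S Sm assms(2)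
    by (simp del: index_mult_mat_vec)
qed

lemma orbit_bounded:
  assumes "w \<in> carrier_vec n" "i < n"
  shows "cmod (orbit i w m) \<le> (\<Sum>j = 0..<n. c * cmod (w $ j))"
proof -
  have Sm: "S ^\<^sub>m m \<in> carrier_mat n n" using S by (rule pow_carrier_mat)
  have "orbit i w m = (\<Sum>j = 0..<n. (S ^\<^sub>m m) $$ (i, j) * w $ j)"
    using S Sm assms by (simp add: orbit_def scalar_prod_def)
  also have "cmod \<dots> \<le> (\<Sum>j = 0..<n. cmod ((S ^\<^sub>m m) $$ (i, j) * w $ j))"
    by (rule norm_sum)
  also have "\<dots> \<le> (\<Sum>j = 0..<n. c * cmod (w $ j))"
    unfolding norm_mult using bounded[of m] S Sm assms
    by (intro sum_mono mult_right_mono) (auto simp: norm_bound_def)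
  finally show ?thesis .
qed

lemma summable_orbit:
  assumes f: "wiener f" and w: "w \<in> carrier_vec n" "i < n"
  shows "summable (\<lambda>m. fps_nth f m * orbit i w m)"
proof (rule summable_norm_cancel, rule summable_comparison_test')
  show "summable (\<lambda>m. cmod (fps_nth f m) * (\<Sum>j = 0..<n. c * cmod (w $ j)))"
    using f unfolding wiener_def by (rule summable_mult2)
  show "norm (norm (fps_nth f m * orbit i w m)) \<le> cmod (fps_nth f m) * (\<Sum>j = 0..<n. c * cmod (w $ j))" for m
    unfolding norm_mult using orbit_bounded[OF w, of m] by (simp add: mult_left_mono)
qed

text \<open>
  The functional calculus is multiplicative for linear factors, because shifting the coefficients
  amounts to shifting the orbit.
\<close>
lemma orbit_sum_affine:
  assumes f: "wiener f" and w: "w \<in> carrier_vec n" "i < n"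
  shows "orbit_sum i w ((fps_const p + fps_const q * fps_X) * f) = orbit_sum i (affine_apply S p q w) f"
proof -
  let ?a = "\<lambda>m. fps_nth f m * orbit i w m"
  let ?b = "\<lambda>m. fps_nth (fps_X * f) m * orbit i w m"
  have sa: "summable ?a" by (rule summable_orbit[OF f w])
  have "orbit i w (Suc m) = orbit i (affine_apply S 0 1 w) m" for m
    using orbit_affine_apply[OF w, of 0 1 m] by simp
  then have b: "?b (Suc m) = fps_nth f m * orbit i (affine_apply S 0 1 w) m" for m
    by simp
  have sb': "summable (\<lambda>m. ?b (Suc m))"
    unfolding b by (rule summable_orbit[OF f affine_apply_carrier[OF S w(1)] w(2)])
  then have sb: "summable ?b" by (subst (asm) summable_Suc_iff)
  have "orbit_sum i w ((fps_const p + fps_const q * fps_X) * f) = (\<Sum>m. p * ?a m + q * ?b m)"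
    unfolding orbit_sum_def by (intro suminf_cong) (simp add: distrib_right mult.assoc)
  also have "\<dots> = p * suminf ?a + q * suminf ?b"
    using sa sb by (simp add: suminf_add[symmetric] suminf_mult summable_mult)
  also have "suminf ?b = (\<Sum>m. ?b (Suc m))"
    using suminf_split_head[OF sb] by simp
  also have "p * suminf ?a + q * (\<Sum>m. ?b (Suc m)) = (\<Sum>m. p * ?a m + q * ?b (Suc m))"
    using sa sb' by (simp add: suminf_add[symmetric] suminf_mult summable_mult)
  also have "\<dots> = orbit_sum i (affine_apply S p q w) f"
    unfolding orbit_sum_def
    by (intro suminf_cong) (simp add: orbit_affine_apply[OF w] algebra_simps)
  finally show ?thesis .
qed

lemma wiener_linear: "wiener (fps_const p + fps_const q * fps_X)"
  unfolding wiener_def by (rule summable_finite[of "{0, 1}"]) (auto simp: fps_X_def)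

lemma orbit_sum_diff:
  assumes "wiener f" "wiener g" "w \<in> carrier_vec n" "i < n"
  shows "orbit_sum i w (f - g) = orbit_sum i w f - orbit_sum i w g"
  unfolding orbit_sum_def fps_sub_nth left_diff_distrib
  using assms by (intro suminf_diff[symmetric] summable_orbit)

lemma orbit_sum_factors:
  assumes "wiener g" and w: "w \<in> carrier_vec n" "i < n"
  shows "orbit_sum i w ((\<Prod>a\<leftarrow>L. fps_X - fps_const a) * g) = orbit_sum i (factors_apply S L w) g"
  using assms(1)
proof (induction L arbitrary: g)
  case (Cons a L)
  have X: "fps_X - fps_const a = fps_const (- a) + fps_const 1 * fps_X"
    by (simp flip: fps_const_neg)
  have "(\<Prod>a\<leftarrow>a # L. fps_X - fps_const a) * g = (\<Prod>a\<leftarrow>L. fps_X - fps_const a) * ((fps_X - fps_const a) * g)"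
    by (simp add: mult_ac)
  also have "orbit_sum i w \<dots> = orbit_sum i (factors_apply S L w) ((fps_X - fps_const a) * g)"
    unfolding X by (intro Cons wiener_mult wiener_linear)
  also have "\<dots> = orbit_sum i (factors_apply S (a # L) w) g"
    unfolding X factors_apply.simps by (rule orbit_sum_affine[OF Cons.prems factors_apply_carrier[OF S w(1)] w(2)])
  finally show ?case .
qed simp

text \<open>
  Since \<open>(z - x) * interp z es = 1 - (\<Prod>e. x - e) * cofactor z es\<close>, and the product of the \<open>x - e\<close> is the
  characteristic polynomial, the functional calculus maps \<open>interp z es\<close> to the resolvent.
\<close>
lemma resolvent_series:
  assumes char: "char_poly S = (\<Prod>e\<leftarrow>es. [:- e, 1:])" and v: "v \<in> carrier_vec n" and i: "i < n"
    and es: "\<And>e. e \<in> set es \<Longrightarrow> cmod e < 1" and z: "z \<notin> set es" and f: "wiener (interp z es)"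
  shows "(\<lambda>m. fps_nth (interp z es) m * orbit i (affine_apply S z (- 1) v) m) sums (v $ i)"
proof -
  let ?P = "\<Prod>a\<leftarrow>es. fps_X - fps_const a" and ?h = "cofactor z es" and ?f = "interp z es"
  have lin: "fps_const z - fps_X = fps_const z + fps_const (- 1) * fps_X"
    by (simp flip: fps_const_neg)
  have h: "wiener ?h" using es by (rule wiener_cofactor)
  have affine_apply: "affine_apply S z (- 1) v \<in> carrier_vec n" by (rule affine_apply_carrier[OF S v])
  have one: "wiener 1" using wiener_const[of 1] by simp
  have g: "wiener ((fps_const z - fps_X) * ?f)"
    unfolding lin by (intro wiener_mult wiener_linear f)
  have "orbit_sum i v ((fps_const z - fps_X) * ?f) = orbit_sum i v 1 - orbit_sum i v (?P * ?h)"
  proof -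
    have Ph: "?P * ?h = 1 - (fps_const z - fps_X) * ?f"
      using interp_identity[OF z] by simp
    show ?thesis
      unfolding Ph orbit_sum_diff[OF one g v i] by simp
  qed
  moreover have "orbit_sum i v (?P * ?h) = 0"
    unfolding orbit_sum_factors[OF h v i] cayley_hamilton[OF S char v]
    using S i by (simp add: orbit_sum_def orbit_def)
  moreover have "orbit_sum i v 1 = v $ i"
  proof -
    have "orbit_sum i v 1 = (\<Sum>m\<in>{0}. fps_nth 1 m * orbit i v m)"
      unfolding orbit_sum_def by (intro suminf_finite) auto
    then show ?thesis using S v by (simp add: orbit_def)
  qed
  ultimately have "orbit_sum i (affine_apply S z (- 1) v) ?f = v $ i"
    unfolding lin orbit_sum_affine[OF f v i] by simp
  then show ?thesis
    using summable_orbit[OF f affine_apply i] unfolding orbit_sum_def by (simp add: sums_iff)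
qed

end

section \<open>Resolvent estimates\<close>

lemma
  assumes "is_norm n \<nu>"
  shows is_norm_zero: "\<nu> (0\<^sub>v n) = 0"
    and is_norm_nonneg: "v \<in> carrier_vec n \<Longrightarrow> 0 \<le> \<nu> v"
    and is_norm_pos: "v \<in> carrier_vec n \<Longrightarrow> v \<noteq> 0\<^sub>v n \<Longrightarrow> 0 < \<nu> v"
    and is_norm_smult: "v \<in> carrier_vec n \<Longrightarrow> \<nu> (c \<cdot>\<^sub>v v) = cmod c * \<nu> v"
    and is_norm_triangle: "v \<in> carrier_vec n \<Longrightarrow> w \<in> carrier_vec n \<Longrightarrow> \<nu> (v + w) \<le> \<nu> v + \<nu> w"
  using assms zero_carrier_vec[of n] unfolding is_norm_def by (blast, blast, force, blast, blast)

text \<open>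
  This makes every norm continuous with respect to coordinatewise convergence.
\<close>
lemma norm_le_unit_vecs:
  assumes \<nu>: "is_norm n \<nu>" and u: "u \<in> carrier_vec n"
  shows "\<nu> u \<le> (\<Sum>i<n. cmod (u $ i) * \<nu> (unit_vec n i))"
proof -
  have "\<nu> (vec n (\<lambda>j. if j < k then u $ j else 0)) \<le> (\<Sum>i<k. cmod (u $ i) * \<nu> (unit_vec n i))" if "k \<le> n" for k
    using that
  proof (induction k)
    case 0
    have "vec n (\<lambda>j. if j < 0 then u $ j else 0) = 0\<^sub>v n" by (intro eq_vecI) auto
    then show ?case by (simp add: is_norm_zero[OF \<nu>])
  next
    case (Suc k)
    have "vec n (\<lambda>j. if j < Suc k then u $ j else 0)
        = vec n (\<lambda>j. if j < k then u $ j else 0) + u $ k \<cdot>\<^sub>v unit_vec n k"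
      using Suc.prems by (intro eq_vecI) (auto simp: less_Suc_eq)
    moreover have "\<nu> (vec n (\<lambda>j. if j < k then u $ j else 0) + u $ k \<cdot>\<^sub>v unit_vec n k)
        \<le> \<nu> (vec n (\<lambda>j. if j < k then u $ j else 0)) + \<nu> (u $ k \<cdot>\<^sub>v unit_vec n k)"
      by (intro is_norm_triangle[OF \<nu>]) auto
    moreover have "\<nu> (u $ k \<cdot>\<^sub>v unit_vec n k) = cmod (u $ k) * \<nu> (unit_vec n k)"
      by (intro is_norm_smult[OF \<nu>]) auto
    ultimately show ?case using Suc by simp
  qed
  from this[of n] have "\<nu> (vec n (\<lambda>j. if j < n then u $ j else 0)) \<le> (\<Sum>i<n. cmod (u $ i) * \<nu> (unit_vec n i))"
    by simp
  moreover have "vec n (\<lambda>j. if j < n then u $ j else 0) = u"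
    using u by (intro eq_vecI) auto
  ultimately show ?thesis by simp
qed

text \<open>
  The resolvent series is a combination of the powers of \<open>S\<close>, so its norm is at most \<open>C\<close> times the sum
  of the moduli of its coefficients.
\<close>
lemma resolvent_estimate_inside_disc:
  fixes S :: "complex mat"
  assumes \<nu>: "is_norm n \<nu>" and S: "S \<in> carrier_mat n n" and n: "0 < n"
    and pow: "\<And>k v. v \<in> carrier_vec n \<Longrightarrow> \<nu> ((S ^\<^sub>m k) *\<^sub>v v) \<le> C * \<nu> v"
    and C: "0 \<le> C"
    and spec: "\<And>e. e \<in> spectrum S \<Longrightarrow> cmod e < 1 \<and> d \<le> cmod (z - e)"
    and z: "1 \<le> cmod z" and d: "0 < d" and v: "v \<in> carrier_vec n"
  shows "\<nu> v \<le> C * (wiener_bound n / d) * \<nu> (affine_apply S z (- 1) v)"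
proof -
  interpret interpolation z d by unfold_locales (use z d in auto)
  obtain es' where es': "char_poly S = (\<Prod>e\<leftarrow>es'. [:- e, 1:])" "length es' = n"
    using char_poly_factorized[OF S] by auto
  \<comment> \<open>Sorting by modulus is what the bound for the derivative of the interpolating function requires.\<close>
  define es where "es = sort_key cmod es'"
  have char: "char_poly S = (\<Prod>e\<leftarrow>es. [:- e, 1:])"
  proof -
    have "prod_mset (image_mset (\<lambda>e. [:- e, 1:]) (mset es)) = prod_mset (image_mset (\<lambda>e. [:- e, 1:]) (mset es'))"
      by (simp add: es_def)
    then show ?thesis using es'(1) by (simp flip: mset_map add: prod_mset_prod_list)
  qed
  have len: "length es = n" using es' by (simp add: es_def)
  have sorted: "sorted_wrt (\<lambda>a b. cmod a \<le> cmod b) es"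
    using sorted_sort_key[of cmod es'] by (simp add: es_def sorted_map)
  have es: "cmod e < 1 \<and> d \<le> cmod (z - e)" if "e \<in> set es" for e
  proof (rule spec)
    show "e \<in> spectrum S"
      unfolding spectrum_root_char_poly[OF S] char using that
      by (auto simp: poly_prod_list prod_list_zero_iff image_iff)
  qed
  have zes: "z \<notin> set es" using es d by force
  let ?f = "interp z es" and ?w = "affine_apply S z (- 1) v"
  have w: "?w \<in> carrier_vec n" using S v by (rule affine_apply_carrier)
  have W: "(\<Sum>m<M. cmod (fps_nth ?f m)) \<le> wiener_bound n / d" for M
    using wiener_norm_interp[OF es sorted] len by simp
  have f: "wiener ?f"
    unfolding wiener_def by (rule summableI_nonneg_bounded[OF _ W]) auto
  have "spectral_radius S < 1"
    using spectral_radius_mem_max(1)[OF S n] spec by auto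
  then obtain c where c: "\<And>k. norm_bound (S ^\<^sub>m k) c"
    using spectral_radius_jnf_norm_bound_less_1_upper_triangular[OF S] by blast
  interpret bounded_powers S n c by unfold_locales (use S c in auto)
  define part where "part = (\<lambda>M. rec_nat (0\<^sub>v n) (\<lambda>m u. u + fps_nth ?f m \<cdot>\<^sub>v ((S ^\<^sub>m m) *\<^sub>v ?w)) M)"
  have part_Suc: "part (Suc M) = part M + fps_nth ?f M \<cdot>\<^sub>v ((S ^\<^sub>m M) *\<^sub>v ?w)" for M
    by (simp add: part_def)
  have part_0: "part 0 = 0\<^sub>v n" by (simp add: part_def)
  have Sw: "(S ^\<^sub>m m) *\<^sub>v ?w \<in> carrier_vec n" for m
    using pow_carrier_mat[OF S, of m] w by auto
  have part: "part M \<in> carrier_vec n" for M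
    by (induction M) (use Sw in \<open>auto simp: part_0 part_Suc\<close>)
  have part_nth: "part M $ i = (\<Sum>m<M. fps_nth ?f m * orbit i ?w m)" if "i < n" for M i
    by (induction M) (use S that part Sw in \<open>auto simp: part_0 part_Suc orbit_def simp del: index_mult_mat_vec\<close>)
  have part_norm: "\<nu> (part M) \<le> (\<Sum>m<M. cmod (fps_nth ?f m)) * (C * \<nu> ?w)" for M
  proof (induction M)
    case 0
    then show ?case by (simp add: part_0 is_norm_zero[OF \<nu>])
  next
    case (Suc M)
    have "\<nu> (part (Suc M)) \<le> \<nu> (part M) + \<nu> (fps_nth ?f M \<cdot>\<^sub>v ((S ^\<^sub>m M) *\<^sub>v ?w))"
      unfolding part_Suc using part Sw by (intro is_norm_triangle[OF \<nu>]) auto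
    also have "\<nu> (fps_nth ?f M \<cdot>\<^sub>v ((S ^\<^sub>m M) *\<^sub>v ?w)) = cmod (fps_nth ?f M) * \<nu> ((S ^\<^sub>m M) *\<^sub>v ?w)"
      by (rule is_norm_smult[OF \<nu> Sw])
    also have "\<dots> \<le> cmod (fps_nth ?f M) * (C * \<nu> ?w)"
      by (intro mult_left_mono pow w) auto
    finally show ?case using Suc by (simp add: distrib_right)
  qed
  have w0: "0 \<le> C * \<nu> ?w" using is_norm_nonneg[OF \<nu> w] C by simp
  define err where "err = (\<lambda>M. \<Sum>i<n. cmod (v $ i - part M $ i) * \<nu> (unit_vec n i))"
  have "\<nu> v \<le> wiener_bound n / d * (C * \<nu> ?w) + err M" for M
  proof -
    have "v = part M + (v - part M)"
      using v part[of M] by (intro eq_vecI) auto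
    then have "\<nu> v \<le> \<nu> (part M) + \<nu> (v - part M)"
      using is_norm_triangle[OF \<nu> part[of M] minus_carrier_vec[OF v part[of M]]] by simp
    also have "\<nu> (v - part M) \<le> (\<Sum>i<n. cmod ((v - part M) $ i) * \<nu> (unit_vec n i))"
      using v part[of M] by (intro norm_le_unit_vecs \<nu>) auto
    also have "\<dots> = err M"
      unfolding err_def using v part[of M] by (intro sum.cong) auto
    also have "\<nu> (part M) \<le> wiener_bound n / d * (C * \<nu> ?w)"
      using part_norm[of M] mult_right_mono[OF W[of M] w0] by linarith
    finally show ?thesis by simp
  qed
  moreover have "err \<longlonglongrightarrow> (\<Sum>i<n. cmod (v $ i - v $ i) * \<nu> (unit_vec n i))"
    unfolding err_def
  proof (intro tendsto_intros)
    fix i assume "i \<in> {..<n}"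
    then have i: "i < n" by simp
    show "(\<lambda>M. part M $ i) \<longlonglongrightarrow> v $ i"
      using resolvent_series[OF char v i _ zes f] es
      unfolding sums_def part_nth[OF i] by blast
  qed
  ultimately have "\<nu> v \<le> wiener_bound n / d * (C * \<nu> ?w) + (\<Sum>i<n. cmod (v $ i - v $ i) * \<nu> (unit_vec n i))"
    by (intro LIMSEQ_le_const[OF tendsto_add[OF tendsto_const]]) auto
  then show ?thesis by (simp add: mult_ac)
qed

lemma op_normD:
  assumes \<nu>: "is_norm n \<nu>" and A: "A \<in> carrier_mat n n" and le: "op_norm n \<nu> A \<le> ereal C"
    and v: "v \<in> carrier_vec n"
  shows "\<nu> (A *\<^sub>v v) \<le> C * \<nu> v"
proof (cases "v = 0\<^sub>v n")
  case True
  then have "A *\<^sub>v v = 0\<^sub>v n" using A by auto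
  then show ?thesis using True by (simp add: is_norm_zero[OF \<nu>])
next
  case False
  then have pos: "\<nu> v > 0" by (rule is_norm_pos[OF \<nu> v])
  define u where "u = of_real (1 / \<nu> v) \<cdot>\<^sub>v v"
  have u: "u \<in> carrier_vec n" using v by (simp add: u_def)
  have "\<nu> u = cmod (of_real (1 / \<nu> v)) * \<nu> v" unfolding u_def by (rule is_norm_smult[OF \<nu> v])
  also have "\<dots> = 1" using pos by (simp add: norm_divide)
  finally have "ereal (\<nu> (A *\<^sub>v u)) \<le> op_norm n \<nu> A"
    unfolding op_norm_def using u by (intro SUP_upper) auto
  then have "\<nu> (A *\<^sub>v u) \<le> C" using le by (metis order_trans ereal_less_eq(3))
  moreover have "A *\<^sub>v u = of_real (1 / \<nu> v) \<cdot>\<^sub>v (A *\<^sub>v v)"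
    unfolding u_def using A v by (intro mult_mat_vec) auto
  moreover have "\<nu> (of_real (1 / \<nu> v) \<cdot>\<^sub>v (A *\<^sub>v v)) = cmod (of_real (1 / \<nu> v)) * \<nu> (A *\<^sub>v v)"
    using A v by (intro is_norm_smult[OF \<nu>]) auto
  ultimately have "1 / \<nu> v * \<nu> (A *\<^sub>v v) \<le> C" using pos by (simp add: norm_divide)
  then show ?thesis using pos by (simp add: field_simps)
qed

text \<open>
  Otherwise the powers of the eigenvalue would grow beyond \<open>C\<close>.
\<close>
lemma spectrum_le_1:
  assumes \<nu>: "is_norm n \<nu>" and T: "T \<in> carrier_mat n n"
    and pow: "\<And>k v. v \<in> carrier_vec n \<Longrightarrow> \<nu> ((T ^\<^sub>m k) *\<^sub>v v) \<le> C * \<nu> v"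
    and e: "e \<in> spectrum T"
  shows "cmod e \<le> 1"
proof (rule ccontr)
  assume "\<not> cmod e \<le> 1"
  then obtain k where k: "C < cmod e ^ k" using real_arch_pow by (metis not_le)
  obtain v where ev: "eigenvector T v e" using e by (auto simp: spectrum_def eigenvalue_def)
  then have v: "v \<in> carrier_vec n" "v \<noteq> 0\<^sub>v n" using T by (auto simp: eigenvector_def)
  then have pos: "\<nu> v > 0" by (rule is_norm_pos[OF \<nu>])
  have "(T ^\<^sub>m k) *\<^sub>v v = e ^ k \<cdot>\<^sub>v v" by (rule eigenvector_pow[OF T ev])
  then have "cmod (e ^ k) * \<nu> v \<le> C * \<nu> v"
    using pow[OF v(1), of k] is_norm_smult[OF \<nu> v(1)] by simp
  then show False using pos k by (simp add: norm_power)
qed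

lemma smult_mat_vec:
  fixes T :: "complex mat"
  assumes "T \<in> carrier_mat n n" "v \<in> carrier_vec n"
  shows "(r \<cdot>\<^sub>m T) *\<^sub>v v = r \<cdot>\<^sub>v (T *\<^sub>v v)"
  using assms by (intro eq_vecI) (auto simp: row_smult)

lemma pow_smult_mat_vec:
  fixes T :: "complex mat"
  assumes T: "T \<in> carrier_mat n n" and v: "v \<in> carrier_vec n"
  shows "((r \<cdot>\<^sub>m T) ^\<^sub>m k) *\<^sub>v v = r ^ k \<cdot>\<^sub>v ((T ^\<^sub>m k) *\<^sub>v v)"
  using v
proof (induction k arbitrary: v)
  case 0
  then show ?case using T by simp
next
  case (Suc k)
  have rT: "r \<cdot>\<^sub>m T \<in> carrier_mat n n" using T by simp
  have Tv: "T *\<^sub>v v \<in> carrier_vec n" using T Suc.prems by auto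
  have Tk: "T ^\<^sub>m k \<in> carrier_mat n n" using T by (rule pow_carrier_mat)
  have "((r \<cdot>\<^sub>m T) ^\<^sub>m Suc k) *\<^sub>v v = ((r \<cdot>\<^sub>m T) ^\<^sub>m k) *\<^sub>v ((r \<cdot>\<^sub>m T) *\<^sub>v v)"
    using assoc_mult_mat_vec[OF pow_carrier_mat[OF rT] rT Suc.prems] by simp
  also have "\<dots> = r ^ k \<cdot>\<^sub>v ((T ^\<^sub>m k) *\<^sub>v (r \<cdot>\<^sub>v (T *\<^sub>v v)))"
    unfolding smult_mat_vec[OF T Suc.prems] using Tv by (intro Suc.IH) auto
  also have "(T ^\<^sub>m k) *\<^sub>v (r \<cdot>\<^sub>v (T *\<^sub>v v)) = r \<cdot>\<^sub>v ((T ^\<^sub>m Suc k) *\<^sub>v v)"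
    using assoc_mult_mat_vec[OF Tk T Suc.prems] by (simp add: mult_mat_vec[OF Tk Tv])
  finally show ?case by (simp add: smult_smult_assoc mult.commute)
qed

text \<open>
  Eigenvalues on the unit circle are reached by a limit: \<open>(1 - t) T\<close> has the same power bound as \<open>T\<close>
  and its spectrum lies inside the disc, at distance at least \<open>d - t\<close> from \<open>z\<close>.
\<close>
lemma resolvent_estimate:
  assumes \<nu>: "is_norm n \<nu>" and T: "T \<in> carrier_mat n n" and n: "0 < n"
    and pow: "\<And>k v. v \<in> carrier_vec n \<Longrightarrow> \<nu> ((T ^\<^sub>m k) *\<^sub>v v) \<le> C * \<nu> v"
    and C: "0 \<le> C"
    and dist: "\<And>e. e \<in> spectrum T \<Longrightarrow> d \<le> cmod (z - e)"
    and z: "1 \<le> cmod z" and d: "0 < d" and v: "v \<in> carrier_vec n"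
  shows "d * \<nu> v \<le> C * wiener_bound n * \<nu> (affine_apply T z (- 1) v)"
proof -
  define W where "W = wiener_bound n"
  have W: "0 \<le> W" by (simp add: W_def wiener_bound_def)
  have Tv: "T *\<^sub>v v \<in> carrier_vec n" using T v by auto
  let ?w = "affine_apply T z (- 1) v"
  have w: "?w \<in> carrier_vec n" by (rule affine_apply_carrier[OF T v])
  have approx: "(d - t) * \<nu> v \<le> C * W * (\<nu> ?w + t * \<nu> (T *\<^sub>v v))" if t: "0 < t" "t < min 1 d" for t
  proof -
    define r :: complex where "r = of_real (1 - t)"
    have r: "cmod r = 1 - t" "r \<noteq> 0" "cmod r \<le> 1" "cmod r < 1" using t by (simp_all add: r_def del: of_real_diff)
    define S where "S = r \<cdot>\<^sub>m T"
    have S: "S \<in> carrier_mat n n" using T by (simp add: S_def)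
    have powS: "\<nu> ((S ^\<^sub>m k) *\<^sub>v u) \<le> C * \<nu> u" if u: "u \<in> carrier_vec n" for k u
    proof -
      have Tu: "(T ^\<^sub>m k) *\<^sub>v u \<in> carrier_vec n" using pow_carrier_mat[OF T, of k] u by auto
      have "\<nu> ((S ^\<^sub>m k) *\<^sub>v u) = cmod (r ^ k) * \<nu> ((T ^\<^sub>m k) *\<^sub>v u)"
        unfolding S_def pow_smult_mat_vec[OF T u] by (rule is_norm_smult[OF \<nu> Tu])
      also have "\<dots> \<le> \<nu> ((T ^\<^sub>m k) *\<^sub>v u)"
        using is_norm_nonneg[OF \<nu> Tu] r(3) by (intro mult_left_le_one_le) (auto simp: norm_power power_le_one)
      also have "\<dots> \<le> C * \<nu> u" by (rule pow[OF u])
      finally show ?thesis .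
    qed
    have spec: "cmod e < 1 \<and> d - t \<le> cmod (z - e)" if e: "e \<in> spectrum S" for e
    proof -
      obtain u where u: "u \<in> carrier_vec n" "u \<noteq> 0\<^sub>v n" "S *\<^sub>v u = e \<cdot>\<^sub>v u"
        using e S by (auto simp: spectrum_def eigenvalue_def eigenvector_def)
      have "r \<cdot>\<^sub>v (T *\<^sub>v u) = e \<cdot>\<^sub>v u"
        using u(3) unfolding S_def smult_mat_vec[OF T u(1)] .
      then have "(1 / r) \<cdot>\<^sub>v (r \<cdot>\<^sub>v (T *\<^sub>v u)) = (1 / r) \<cdot>\<^sub>v (e \<cdot>\<^sub>v u)" by simp
      then have "T *\<^sub>v u = (e / r) \<cdot>\<^sub>v u" using r(2) by (simp add: smult_smult_assoc)
      then have mem: "e / r \<in> spectrum T"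
        using u T by (auto simp: spectrum_def eigenvalue_def eigenvector_def)
      define \<mu> where "\<mu> = e / r"
      have \<mu>: "cmod \<mu> \<le> 1" unfolding \<mu>_def by (rule spectrum_le_1[OF \<nu> T pow mem])
      have e: "e = r * \<mu>" using r(2) by (simp add: \<mu>_def)
      have "cmod e \<le> cmod r * 1" unfolding e norm_mult using \<mu> by (intro mult_left_mono) auto
      moreover have "cmod (z - \<mu>) \<le> cmod (z - e) + cmod (e - \<mu>)"
        using norm_triangle_ineq[of "z - e" "e - \<mu>"] by simp
      moreover have "cmod (e - \<mu>) \<le> t"
      proof -
        have "e - \<mu> = - of_real t * \<mu>" by (simp add: e r_def algebra_simps)
        then have "cmod (e - \<mu>) = t * cmod \<mu>" using t by (simp add: norm_mult)
        then show ?thesis using t \<mu> by (simp add: mult_left_le)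
      qed
      moreover have "d \<le> cmod (z - \<mu>)" using dist mem by (simp add: \<mu>_def)
      ultimately show ?thesis using r by auto
    qed
    have dt: "0 < d - t" using t by simp
    have "\<nu> v \<le> C * (wiener_bound n / (d - t)) * \<nu> (affine_apply S z (- 1) v)"
      by (rule resolvent_estimate_inside_disc[OF \<nu> S n powS C spec z dt v])
    then have "(d - t) * \<nu> v \<le> C * W * \<nu> (affine_apply S z (- 1) v)"
      using dt by (simp add: W_def field_simps)
    also have "affine_apply S z (- 1) v = ?w + of_real t \<cdot>\<^sub>v (T *\<^sub>v v)"
      unfolding affine_apply_def S_def smult_mat_vec[OF T v] using v Tv
      by (intro eq_vecI) (auto simp: r_def algebra_simps simp del: index_mult_mat_vec)
    also have "\<nu> \<dots> \<le> \<nu> ?w + \<nu> (of_real t \<cdot>\<^sub>v (T *\<^sub>v v))"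
      using w Tv by (intro is_norm_triangle[OF \<nu>]) auto
    also have "\<nu> (of_real t \<cdot>\<^sub>v (T *\<^sub>v v)) = cmod (of_real t) * \<nu> (T *\<^sub>v v)"
      by (rule is_norm_smult[OF \<nu> Tv])
    finally show ?thesis
      using t C W by (simp add: mult_left_mono)
  qed
  have "((\<lambda>t. (d - t) * \<nu> v) \<longlongrightarrow> (d - 0) * \<nu> v) (at_right 0)"
    by (intro tendsto_intros)
  moreover have "((\<lambda>t. C * W * (\<nu> ?w + t * \<nu> (T *\<^sub>v v))) \<longlongrightarrow> C * W * (\<nu> ?w + 0 * \<nu> (T *\<^sub>v v))) (at_right 0)"
    by (intro tendsto_intros)
  moreover have "eventually (\<lambda>t. (d - t) * \<nu> v \<le> C * W * (\<nu> ?w + t * \<nu> (T *\<^sub>v v))) (at_right 0)"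
    using eventually_at_right_less[of 0] eventually_at_right_field[of _ 0] approx d
    by (subst eventually_at_right_field) (auto intro!: exI[of _ "min 1 d"])
  ultimately have "(d - 0) * \<nu> v \<le> C * W * (\<nu> ?w + 0 * \<nu> (T *\<^sub>v v))"
    by (intro tendsto_le[OF trivial_limit_at_right_real])
  then show ?thesis by (simp add: W_def)
qed

lemma K_le_wiener_bound:
  assumes n: "1 \<le> n" and C: "1 \<le> C"
  shows "K n C \<le> ereal (C * wiener_bound n)"
  unfolding K_def
proof (rule Sup_least, safe)
  fix \<nu> T z
  assume \<nu>: "is_norm n \<nu>" and T: "T \<in> carrier_mat n n" and pb: "power_bounded n \<nu> C T"
    and z: "1 \<le> cmod z" and zT: "z \<notin> spectrum T"
  note R = resolvent_is_inverse[OF T zT]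
  have n': "0 < n" using n by simp
  have fin: "finite (spectrum T)" "spectrum T \<noteq> {}"
    using card_finite_spectrum[OF T] spectrum_non_empty[OF T n'] by auto
  define d where "d = spec_dist z T"
  have dist: "d \<le> cmod (z - e)" if "e \<in> spectrum T" for e
    unfolding d_def spec_dist_def using fin that by (intro Min_le) auto
  have d: "0 < d"
    unfolding d_def spec_dist_def using fin zT by (subst Min_gr_iff) auto
  have pow: "\<nu> ((T ^\<^sub>m k) *\<^sub>v v) \<le> C * \<nu> v" if "v \<in> carrier_vec n" for k v
    using op_normD[OF \<nu> pow_carrier_mat[OF T] _ that] pb unfolding power_bounded_def by blast
  have "op_norm n \<nu> (resolvent n z T) \<le> ereal (C * wiener_bound n / d)"
    unfolding op_norm_def
  proof (rule SUP_least)
    fix u assume "u \<in> {v \<in> carrier_vec n. \<nu> v \<le> 1}"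
    then have u: "u \<in> carrier_vec n" "\<nu> u \<le> 1" by auto
    define v where "v = resolvent n z T *\<^sub>v u"
    have v: "v \<in> carrier_vec n" unfolding v_def using R(1) u by auto
    have "affine_apply T z (- 1) v = (z \<cdot>\<^sub>m 1\<^sub>m n - T) *\<^sub>v v"
    proof -
      have "(z \<cdot>\<^sub>m 1\<^sub>m n - T) *\<^sub>v v = (z \<cdot>\<^sub>m 1\<^sub>m n) *\<^sub>v v - T *\<^sub>v v"
        using T v by (intro minus_mult_distrib_mat_vec[of _ n n]) auto
      also have "(z \<cdot>\<^sub>m 1\<^sub>m n) *\<^sub>v v = z \<cdot>\<^sub>v v"
        using smult_mat_vec[of "1\<^sub>m n" n v z] v by simp
      finally show ?thesis
        unfolding affine_apply_def using v T by (intro eq_vecI) (auto simp del: index_mult_mat_vec)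
    qed
    also have "\<dots> = ((z \<cdot>\<^sub>m 1\<^sub>m n - T) * resolvent n z T) *\<^sub>v u"
      unfolding v_def using T R(1) u by (intro assoc_mult_mat_vec[symmetric]) auto
    also have "\<dots> = u" unfolding R(2) using u by simp
    finally have eq: "affine_apply T z (- 1) v = u" .
    have "d * \<nu> v \<le> C * wiener_bound n * \<nu> u"
      using resolvent_estimate[OF \<nu> T n' pow _ dist z d v] C unfolding eq by simp
    also have "\<dots> \<le> C * wiener_bound n * 1"
      using u C by (intro mult_left_mono) (auto simp: wiener_bound_def)
    finally have "\<nu> v \<le> C * wiener_bound n / d" using d by (simp add: field_simps)
    then show "ereal (\<nu> (resolvent n z T *\<^sub>v u)) \<le> ereal (C * wiener_bound n / d)"
      by (simp add: v_def)
  qed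
  then have "op_norm n \<nu> (resolvent n z T) * ereal d \<le> ereal (C * wiener_bound n / d) * ereal d"
    using d by (intro ereal_mult_right_mono) auto
  also have "\<dots> = ereal (C * wiener_bound n)" using d by simp
  finally show "op_norm n \<nu> (resolvent n z T) * ereal (spec_dist z T) \<le> ereal (C * wiener_bound n)"
    by (simp add: d_def)
qed

text \<open>
  Estimating \<open>n\<close> and \<open>sqrt n\<close> by \<open>n powr (3 / 2)\<close> leaves \<open>1 + pi + 2 * sqrt 2 / 3 * pi\<close>, about 7.1, where the claimed
  constant is about 8.1.
\<close>
lemma wiener_bound_le:
  assumes "1 \<le> n"
  shows "wiener_bound n \<le> (5 * pi / 3 + 2 * sqrt 2) * real n powr (3 / 2)"
proof -
  define q where "q = real n * sqrt (real n)"
  have q: "real n powr (3 / 2) = q"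
  proof -
    have "real n powr (3 / 2) = real n powr (1 + 1 / 2)" by simp
    also have "\<dots> = q" using assms unfolding powr_add by (simp add: q_def powr_half_sqrt)
    finally show ?thesis .
  qed
  have s: "1 \<le> sqrt (real n)" using assms by simp
  have nq: "real n \<le> q" unfolding q_def using s by (simp add: mult_le_cancel_left1)
  have "sqrt (real n) \<le> real n" using assms by (intro real_le_lsqrt) (auto simp: power2_eq_square)
  then have sq: "sqrt (real n) \<le> q" using nq by linarith
  have s2: "sqrt 2 \<le> 3 / 2" "7 / 5 \<le> sqrt 2"
    by (rule real_le_lsqrt real_le_rsqrt; simp add: power2_eq_square)+
  have "wiener_bound n = sqrt n + pi * n + pi * (2 * sqrt 2 / 3) * q"
    by (simp add: wiener_bound_def q_def algebra_simps)
  also have "\<dots> \<le> q + pi * q + pi * (2 * sqrt 2 / 3) * q"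
    using nq sq by (intro add_mono mult_left_mono) auto
  also have "\<dots> = (1 + pi + pi * (2 * sqrt 2 / 3)) * q" by (simp add: algebra_simps)
  also have "\<dots> \<le> (5 * pi / 3 + 2 * sqrt 2) * q"
  proof (rule mult_right_mono)
    have "pi * (2 * sqrt 2 / 3) \<le> pi * 1" using s2 by (intro mult_left_mono) auto
    moreover have "pi \<le> 4" using pi_less_4 by simp
    ultimately show "1 + pi + pi * (2 * sqrt 2 / 3) \<le> 5 * pi / 3 + 2 * sqrt 2"
      using s2 by linarith
    show "0 \<le> q" by (simp add: q_def)
  qed
  finally show ?thesis by (simp add: q)
qed

lemma wiener_bound_asymptotic:
  "(\<lambda>n. real n powr (- 3 / 2) * wiener_bound n) \<longlonglongrightarrow> pi * (2 * sqrt 2 / 3)"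
proof (rule Lim_transform_eventually)
  show "(\<lambda>n. 1 / real n + pi * (1 / sqrt (real n)) + pi * (2 * sqrt 2 / 3)) \<longlonglongrightarrow> pi * (2 * sqrt 2 / 3)"
  proof -
    have "(\<lambda>n. 1 / sqrt (real n)) \<longlonglongrightarrow> 0"
      by (intro tendsto_divide_0[OF tendsto_const] filterlim_at_top_imp_at_infinity
          filterlim_compose[OF sqrt_at_top filterlim_real_sequentially])
    from tendsto_add[OF tendsto_add[OF lim_1_over_n tendsto_mult[OF tendsto_const[of pi] this]] tendsto_const[of "pi * (2 * sqrt 2 / 3)"]]
    show ?thesis by simp
  qed
  show "\<forall>\<^sub>F n in sequentially. 1 / real n + pi * (1 / sqrt (real n)) + pi * (2 * sqrt 2 / 3)
      = real n powr (- 3 / 2) * wiener_bound n"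
  proof (rule eventually_sequentiallyI[of 1])
    fix n :: nat assume n: "1 \<le> n"
    define s where "s = sqrt (real n)"
    have s: "s > 0" "real n = s * s" using n by (simp_all add: s_def)
    have "real n powr (- 3 / 2) = 1 / real n powr (1 + 1 / 2)"
      by (simp add: powr_minus_divide)
    also have "real n powr (1 + 1 / 2) = s * s * s"
      unfolding powr_add using n s by (simp add: powr_half_sqrt s_def[symmetric])
    finally have p: "real n powr (- 3 / 2) = 1 / (s * s * s)" .
    show "1 / real n + pi * (1 / sqrt (real n)) + pi * (2 * sqrt 2 / 3)
        = real n powr (- 3 / 2) * wiener_bound n"
      unfolding p wiener_bound_def s_def[symmetric] unfolding s(2) using s(1) by (simp add: field_simps)
  qed
qed

section \<open>The bounds for the supremum\<close>

theorem mainTheorem1: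
  shows "(\<forall>(n :: nat) (C :: real). 1 \<le> n \<longrightarrow> 1 \<le> C \<longrightarrow>
           K n C \<le> ereal (C * (5 * pi / 3 + 2 * sqrt 2) * real n powr (3 / 2)))
    \<and> (\<forall>C :: real. 1 \<le> C \<longrightarrow> limsup (\<lambda>n. ereal (real n powr (- 3 / 2)) * K n C) \<le> ereal (5 * pi / 3 * C))"
proof (intro conjI allI impI)
  fix n :: nat and C :: real assume n: "1 \<le> n" and C: "1 \<le> C"
  have "K n C \<le> ereal (C * wiener_bound n)" by (rule K_le_wiener_bound[OF n C])
  also have "\<dots> \<le> ereal (C * (5 * pi / 3 + 2 * sqrt 2) * real n powr (3 / 2))"
    using mult_left_mono[OF wiener_bound_le[OF n], of C] C by (simp add: mult.assoc)
  finally show "K n C \<le> ereal (C * (5 * pi / 3 + 2 * sqrt 2) * real n powr (3 / 2))" .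
next
  fix C :: real assume C: "1 \<le> C"
  have "limsup (\<lambda>n. ereal (real n powr (- 3 / 2)) * K n C)
      \<le> limsup (\<lambda>n. ereal (C * (real n powr (- 3 / 2) * wiener_bound n)))"
  proof (rule Limsup_mono, rule eventually_sequentiallyI[of 1])
    fix n :: nat assume "1 \<le> n"
    then have "ereal (real n powr (- 3 / 2)) * K n C \<le> ereal (real n powr (- 3 / 2)) * ereal (C * wiener_bound n)"
      using C by (intro ereal_mult_left_mono K_le_wiener_bound) auto
    then show "ereal (real n powr (- 3 / 2)) * K n C \<le> ereal (C * (real n powr (- 3 / 2) * wiener_bound n))"
      by (simp add: mult_ac)
  qed
  also have "\<dots> = ereal (C * (pi * (2 * sqrt 2 / 3)))"
    by (intro lim_imp_Limsup tendsto_ereal tendsto_mult tendsto_const wiener_bound_asymptotic) simp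
  also have "\<dots> \<le> ereal (5 * pi / 3 * C)"
  proof -
    have "sqrt 2 \<le> 5 / 2" by (rule real_le_lsqrt) (simp_all add: power2_eq_square)
    then have "C * (pi * (2 * sqrt 2 / 3)) \<le> C * (pi * (5 / 3))"
      using C by (intro mult_left_mono) auto
    then show ?thesis by (simp add: mult_ac)
  qed
  finally show "limsup (\<lambda>n. ereal (real n powr (- 3 / 2)) * K n C) \<le> ereal (5 * pi / 3 * C)" .
qed

end
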